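(* Let $M$ be an $n$-dimensional manifold, $n>2$, and let $(g,\xi,\lambda,\mu)$ be an $\eta$-Ricci soliton on $M$ with $\eta$ the $g$-dual $1$-form of $\xi$. i) If $\eta$ is a solution of the Schr\"odinger-Ricci equation, then: a) $\eta$ is a Schr\"odinger-Ricci harmonic form if and only if $scal+\mu|\xi|^2$ is constant; b) $\eta$ is a harmonic form if and only if $i_{Q\xi}g=d(scal+\mu|\xi|^2)$; also $\eta$ harmonic implies $\xi\in\ker Q$. ii) If $\eta$ is a Schr\"odinger-Ricci harmonic form, then: a) $\eta$ is a solution of the Schr\"odinger-Ricci equation if and only if $scal+\mu|\xi|^2$ is constant; b) $\eta$ is a harmonic form if and only if $\xi\in\ker Q$. iii) If $\eta$ is a harmonic form, then: a) $\eta$ is a solution of the Schr\"odinger-Ricci equation if and only if $\xi\in\ker Q$; b) $\eta$ is a Schr\"odinger-Ricci harmonic form if and only if $\xi\in\ker Q$.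
   Context: $g$ is a Riemannian metric on $M$, $\nabla$ its Levi-Civita connection, $S$ its Ricci curvature tensor field, $scal$ its scalar curvature, $Q$ the Ricci operator, $g(QX,Y)=S(X,Y)$. $i_Xg=X^{\flat}=g(X,\cdot)$, and $\sharp$ is the inverse of $\flat$. The $g$-dual $1$-form of $\xi$ is $\eta=\xi^{\flat}$. The data $(g,\xi,\lambda,\mu)$, with $\lambda,\mu$ real constants, is an $\eta$-Ricci soliton if $L_{\xi}g+2S+2\lambda g+2\mu\,\eta\otimes\eta=0$, where $L$ is the Lie derivative. For a $1$-form $\gamma$, $S_{\sharp}(\gamma)=g(Q\gamma^{\sharp},\cdot)$. $\Delta$ denotes the Laplacian on $1$-forms (called the Laplace-Hodge operator), with the convention that for every vector field $X$ $$div(L_Xg)=(\Delta+S_{\sharp})(X^{\flat})+d(div(X)),$$ where for a symmetric $(0,2)$-tensor field $T$, $div(T)(Y)=\sum_i(\nabla_{E_i}T)(E_i,Y)$ for a local orthonormal frame $\{E_i\}$. A $1$-form $\gamma$ is: a solution of the Schr\"odinger-Ricci equation if $div(L_{\gamma^{\sharp}}g)=0$, i.e. $(\Delta+S_{\sharp})(\gamma)+d(div(\gamma^{\sharp}))=0$; Schr\"odinger-Ricci harmonic if $(\Delta+S_{\sharp})(\gamma)=0$; harmonic if $\Delta(\gamma)=0$, which is taken to be equivalent to $\gamma$ being closed and divergence free.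
   Formalization: M is additionally assumed connected, since on a disconnected M the "constant" criteria in i)a) and ii)a) can fail; the convention "harmonic iff closed and divergence free" is assumed for η only. *)

theory Defs
  imports "HOL-Analysis.Analysis"
begin

section \<open>Smooth manifolds\<close>

definition partial :: "'n \<Rightarrow> (real^'n \<Rightarrow> real) \<Rightarrow> real^'n \<Rightarrow> real" where
  "partial i f x = frechet_derivative f (at x) (axis i 1)"

text \<open>For open \<open>S\<close> this is the class \<open>C\<^sup>k\<close>.\<close>

primrec Ck_on :: "nat \<Rightarrow> (real^'n) set \<Rightarrow> (real^'n \<Rightarrow> real) \<Rightarrow> bool" where
  "Ck_on 0 S f \<longleftrightarrow> continuous_on S f"
| "Ck_on (Suc k) S f \<longleftrightarrow> f differentiable_on S \<and> (\<forall>i. Ck_on k S (partial i f))"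

definition smooth_on :: "(real^'n) set \<Rightarrow> (real^'n \<Rightarrow> real) \<Rightarrow> bool" where
  "smooth_on S f \<longleftrightarrow> (\<forall>k. Ck_on k S f)"

text \<open>A chart is a pair of a domain and a coordinate map; only the values of the coordinate map on
  the domain matter. The dimension of the manifold is \<open>CARD('n)\<close>.\<close>

type_synonym ('a, 'n) chart = "'a set \<times> ('a \<Rightarrow> real^'n)"

definition chart_inv :: "('a, 'n) chart \<Rightarrow> real^'n \<Rightarrow> 'a" where
  "chart_inv c = inv_into (fst c) (snd c)"

definition is_chart :: "('a::topological_space, 'n::finite) chart \<Rightarrow> bool" where
  "is_chart c \<longleftrightarrow> open (fst c) \<and> open (snd c ` fst c) \<and>
     homeomorphism (fst c) (snd c ` fst c) (snd c) (chart_inv c)"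

text \<open>The underlying space of the manifold with atlas \<open>A\<close> is \<open>carrier_of A\<close>, an open set of the
  ambient Hausdorff, second countable type. The atlas need not be maximal: all notions below
  are unchanged when compatible charts are added.\<close>

definition carrier_of :: "('a, 'n) chart set \<Rightarrow> 'a set" where
  "carrier_of A = (\<Union>c\<in>A. fst c)"

definition smooth_manifold ::
    "('a::{t2_space, second_countable_topology}, 'n::finite) chart set \<Rightarrow> bool" where
  "smooth_manifold A \<longleftrightarrow> (\<forall>c\<in>A. is_chart c) \<and>
     (\<forall>c\<in>A. \<forall>c'\<in>A. \<forall>i. smooth_on (snd c ` (fst c \<inter> fst c')) (\<lambda>x. snd c' (chart_inv c x) $ i))"

definition smooth_in :: "('a, 'n::finite) chart \<Rightarrow> ('a \<Rightarrow> real) \<Rightarrow> bool" where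
  "smooth_in c f \<longleftrightarrow> smooth_on (snd c ` fst c) (f \<circ> chart_inv c)"

text \<open>The coordinate derivative \<open>\<partial>f / \<partial>x\<^sup>i\<close> at \<open>p\<close> in the chart \<open>c\<close>.\<close>

definition pd :: "('a, 'n::finite) chart \<Rightarrow> 'n \<Rightarrow> ('a \<Rightarrow> real) \<Rightarrow> 'a \<Rightarrow> real" where
  "pd c i f p = partial i (f \<circ> chart_inv c) (snd c p)"

definition jac :: "('a, 'n::finite) chart \<Rightarrow> ('a, 'n) chart \<Rightarrow> 'a \<Rightarrow> real^'n^'n" where
  "jac c c' p = (\<chi> i j. pd c j (\<lambda>q. snd c' q $ i) p)"

section \<open>Tensor fields\<close>

text \<open>A tensor field is a family of component functions, one for each chart, related by
  the usual transformation laws on overlaps of charts. For a chart \<open>c\<close> and a point \<open>p\<close> of its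
  domain, \<open>X c p $ i\<close> is \<open>X\<^sup>i(p)\<close> if \<open>X\<close> is a vector field and \<open>X(\<partial>\<^sub>i)(p)\<close> if \<open>X\<close> is a 1-form, and
  \<open>T c p $ i $ j\<close> is \<open>T(\<partial>\<^sub>i, \<partial>\<^sub>j)(p)\<close> for a (0,2)-tensor field \<open>T\<close>. Values at points outside the
  domain of \<open>c\<close> are irrelevant. Scalar fields are plain functions on the manifold.\<close>

type_synonym ('a, 'n) vfield = "('a, 'n) chart \<Rightarrow> 'a \<Rightarrow> real^'n"
type_synonym ('a, 'n) form1 = "('a, 'n) chart \<Rightarrow> 'a \<Rightarrow> real^'n"
type_synonym ('a, 'n) tensor2 = "('a, 'n) chart \<Rightarrow> 'a \<Rightarrow> real^'n^'n"

definition smooth_vfield :: "('a, 'n::finite) chart set \<Rightarrow> ('a, 'n) vfield \<Rightarrow> bool" where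
  "smooth_vfield A X \<longleftrightarrow>
     (\<forall>c\<in>A. \<forall>i. smooth_in c (\<lambda>p. X c p $ i)) \<and>
     (\<forall>c\<in>A. \<forall>c'\<in>A. \<forall>p\<in>fst c \<inter> fst c'. X c' p = jac c c' p *v X c p)"

definition smooth_tensor2 :: "('a, 'n::finite) chart set \<Rightarrow> ('a, 'n) tensor2 \<Rightarrow> bool" where
  "smooth_tensor2 A T \<longleftrightarrow>
     (\<forall>c\<in>A. \<forall>i j. smooth_in c (\<lambda>p. T c p $ i $ j)) \<and>
     (\<forall>c\<in>A. \<forall>c'\<in>A. \<forall>p\<in>fst c \<inter> fst c'.
        T c p = transpose (jac c c' p) ** T c' p ** jac c c' p)"

definition field_eq ::
    "('a, 'n) chart set \<Rightarrow> (('a, 'n) chart \<Rightarrow> 'a \<Rightarrow> 'b) \<Rightarrow> (('a, 'n) chart \<Rightarrow> 'a \<Rightarrow> 'b) \<Rightarrow> bool" where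
  "field_eq A T T' \<longleftrightarrow> (\<forall>c\<in>A. \<forall>p\<in>fst c. T c p = T' c p)"

abbreviation zero_field :: "('a, 'n) chart \<Rightarrow> 'a \<Rightarrow> 'b::zero" where
  "zero_field \<equiv> (\<lambda>c p. 0)"

text \<open>Scalars that are computed from components are evaluated in some chart around the point; the
  value does not depend on the choice.\<close>

definition chart_at :: "('a, 'n) chart set \<Rightarrow> 'a \<Rightarrow> ('a, 'n) chart" where
  "chart_at A p = (SOME c. c \<in> A \<and> p \<in> fst c)"

definition exterior_d :: "('a \<Rightarrow> real) \<Rightarrow> ('a, 'n::finite) form1" where
  "exterior_d f c p = (\<chi> i. pd c i f p)"

definition closed_form :: "('a, 'n::finite) chart set \<Rightarrow> ('a, 'n) form1 \<Rightarrow> bool" where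
  "closed_form A \<gamma> \<longleftrightarrow>
     (\<forall>c\<in>A. \<forall>p\<in>fst c. \<forall>i j. pd c i (\<lambda>q. \<gamma> c q $ j) p - pd c j (\<lambda>q. \<gamma> c q $ i) p = 0)"

definition tensor_square :: "('a, 'n::finite) form1 \<Rightarrow> ('a, 'n) tensor2" where
  "tensor_square \<gamma> c p = (\<chi> i j. \<gamma> c p $ i * \<gamma> c p $ j)"

text \<open>\<open>(L\<^sub>X T)(\<partial>\<^sub>i, \<partial>\<^sub>j) = X(T(\<partial>\<^sub>i, \<partial>\<^sub>j)) - T([X, \<partial>\<^sub>i], \<partial>\<^sub>j) - T(\<partial>\<^sub>i, [X, \<partial>\<^sub>j])\<close>, where
  \<open>[X, \<partial>\<^sub>i] = - \<Sum>\<^sub>k (\<partial>\<^sub>i X\<^sup>k) \<partial>\<^sub>k\<close>.\<close>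

definition lie_deriv :: "('a, 'n::finite) vfield \<Rightarrow> ('a, 'n) tensor2 \<Rightarrow> ('a, 'n) tensor2" where
  "lie_deriv X T c p = (\<chi> i j. \<Sum>k\<in>UNIV.
      X c p $ k * pd c k (\<lambda>q. T c q $ i $ j) p
      + T c p $ k $ j * pd c i (\<lambda>q. X c q $ k) p
      + T c p $ i $ k * pd c j (\<lambda>q. X c q $ k) p)"

section \<open>Riemannian geometry\<close>

definition riemannian_metric :: "('a, 'n::finite) chart set \<Rightarrow> ('a, 'n) tensor2 \<Rightarrow> bool" where
  "riemannian_metric A g \<longleftrightarrow> smooth_tensor2 A g \<and>
     (\<forall>c\<in>A. \<forall>p\<in>fst c. transpose (g c p) = g c p \<and> (\<forall>v. v \<noteq> 0 \<longrightarrow> v \<bullet> (g c p *v v) > 0))"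

definition flat :: "('a, 'n::finite) tensor2 \<Rightarrow> ('a, 'n) vfield \<Rightarrow> ('a, 'n) form1" where
  "flat g X c p = (\<chi> j. \<Sum>i\<in>UNIV. g c p $ i $ j * X c p $ i)"

definition sharp :: "('a, 'n::finite) tensor2 \<Rightarrow> ('a, 'n) form1 \<Rightarrow> ('a, 'n) vfield" where
  "sharp g \<gamma> c p = matrix_inv (g c p) *v \<gamma> c p"

definition norm_sq ::
    "('a, 'n::finite) chart set \<Rightarrow> ('a, 'n) tensor2 \<Rightarrow> ('a, 'n) vfield \<Rightarrow> 'a \<Rightarrow> real" where
  "norm_sq A g X p = (let c = chart_at A p in X c p \<bullet> (g c p *v X c p))"

text \<open>The trace \<open>\<Sum>\<^sub>i\<^sub>j g\<^sup>i\<^sup>j B\<^sub>i\<^sub>j\<close> of a bilinear form \<open>B\<close> with respect to an inner product \<open>G\<close>. It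
  equals \<open>\<Sum>\<^sub>a B(E\<^sub>a, E\<^sub>a)\<close> for every orthonormal basis \<open>E\<close>, see \<open>metric_trace_orthonormal\<close> below.\<close>

definition metric_trace :: "real^'n^'n \<Rightarrow> real^'n^'n \<Rightarrow> real" where
  "metric_trace G B = (\<Sum>i\<in>UNIV. \<Sum>j\<in>UNIV. matrix_inv G $ i $ j * B $ i $ j)"

text \<open>Christoffel symbols \<open>\<Gamma>\<^sup>k\<^sub>i\<^sub>j\<close> of the Levi-Civita connection, \<open>\<nabla>\<^bsub>\<partial>\<^sub>i\<^esub> \<partial>\<^sub>j = \<Sum>\<^sub>k \<Gamma>\<^sup>k\<^sub>i\<^sub>j \<partial>\<^sub>k\<close>. That this
  connection is torsion-free and metric is recorded in \<open>christoffel_symmetric\<close> and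
  \<open>levi_civita_metric\<close> below.\<close>

definition christoffel ::
    "('a, 'n::finite) tensor2 \<Rightarrow> ('a, 'n) chart \<Rightarrow> 'n \<Rightarrow> 'n \<Rightarrow> 'n \<Rightarrow> 'a \<Rightarrow> real" where
  "christoffel g c k i j p = (1/2) * (\<Sum>l\<in>UNIV. matrix_inv (g c p) $ k $ l *
      (pd c i (\<lambda>q. g c q $ j $ l) p + pd c j (\<lambda>q. g c q $ i $ l) p - pd c l (\<lambda>q. g c q $ i $ j) p))"

text \<open>\<open>nabla_form g \<gamma> c p $ i $ j = (\<nabla>\<^bsub>\<partial>\<^sub>i\<^esub> \<gamma>)(\<partial>\<^sub>j)\<close> and
  \<open>nabla_tensor g T c p k $ i $ j = (\<nabla>\<^bsub>\<partial>\<^sub>k\<^esub> T)(\<partial>\<^sub>i, \<partial>\<^sub>j)\<close>.\<close>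

definition nabla_form :: "('a, 'n::finite) tensor2 \<Rightarrow> ('a, 'n) form1 \<Rightarrow> ('a, 'n) tensor2" where
  "nabla_form g \<gamma> c p = (\<chi> i j. pd c i (\<lambda>q. \<gamma> c q $ j) p
      - (\<Sum>k\<in>UNIV. christoffel g c k i j p * \<gamma> c p $ k))"

definition nabla_tensor ::
    "('a, 'n::finite) tensor2 \<Rightarrow> ('a, 'n) tensor2 \<Rightarrow> ('a, 'n) chart \<Rightarrow> 'a \<Rightarrow> 'n \<Rightarrow> real^'n^'n" where
  "nabla_tensor g T c p k = (\<chi> i j. pd c k (\<lambda>q. T c q $ i $ j) p
      - (\<Sum>l\<in>UNIV. christoffel g c l k i p * T c p $ l $ j)
      - (\<Sum>l\<in>UNIV. christoffel g c l k j p * T c p $ i $ l))"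

text \<open>\<open>div X = \<Sum>\<^sub>i (\<nabla>\<^bsub>\<partial>\<^sub>i\<^esub> X)\<^sup>i\<close>.\<close>

definition div_vfield ::
    "('a, 'n::finite) chart set \<Rightarrow> ('a, 'n) tensor2 \<Rightarrow> ('a, 'n) vfield \<Rightarrow> 'a \<Rightarrow> real" where
  "div_vfield A g X p = (let c = chart_at A p in
      \<Sum>i\<in>UNIV. pd c i (\<lambda>q. X c q $ i) p + (\<Sum>j\<in>UNIV. christoffel g c i i j p * X c p $ j))"

text \<open>\<open>div(T)(Y) = \<Sum>\<^sub>a (\<nabla>\<^bsub>E\<^sub>a\<^esub> T)(E\<^sub>a, Y)\<close> for an orthonormal frame \<open>E\<close>.\<close>

definition div_tensor :: "('a, 'n::finite) tensor2 \<Rightarrow> ('a, 'n) tensor2 \<Rightarrow> ('a, 'n) form1" where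
  "div_tensor g T c p = (\<chi> k. metric_trace (g c p) (\<chi> i j. nabla_tensor g T c p i $ j $ k))"

text \<open>\<open>S(Y, Z)\<close> is the trace of \<open>X \<mapsto> R(X, Y)Z\<close> with
  \<open>R(X, Y) = \<nabla>\<^sub>X\<nabla>\<^sub>Y - \<nabla>\<^sub>Y\<nabla>\<^sub>X - \<nabla>\<^bsub>[X, Y]\<^esub>\<close>, so that round spheres have positive Ricci curvature.\<close>

definition ricci :: "('a, 'n::finite) tensor2 \<Rightarrow> ('a, 'n) tensor2" where
  "ricci g c p = (\<chi> j k. \<Sum>i\<in>UNIV.
      pd c i (christoffel g c i j k) p - pd c j (christoffel g c i i k) p
      + (\<Sum>m\<in>UNIV. christoffel g c i i m p * christoffel g c m j k p
                 - christoffel g c i j m p * christoffel g c m i k p))"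

definition scal :: "('a, 'n::finite) chart set \<Rightarrow> ('a, 'n) tensor2 \<Rightarrow> 'a \<Rightarrow> real" where
  "scal A g p = (let c = chart_at A p in metric_trace (g c p) (ricci g c p))"

text \<open>The Ricci operator: \<open>QX\<close> is the vector field with \<open>g(QX, Y) = S(X, Y)\<close> for all \<open>Y\<close>.\<close>

definition ricci_op :: "('a, 'n::finite) tensor2 \<Rightarrow> ('a, 'n) vfield \<Rightarrow> ('a, 'n) vfield" where
  "ricci_op g X = sharp g (\<lambda>c p. \<chi> j. \<Sum>i\<in>UNIV. ricci g c p $ i $ j * X c p $ i)"

definition S_sharp :: "('a, 'n::finite) tensor2 \<Rightarrow> ('a, 'n) form1 \<Rightarrow> ('a, 'n) form1" where
  "S_sharp g \<gamma> = flat g (ricci_op g (sharp g \<gamma>))"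

text \<open>The Laplacian on 1-forms is \<open>(\<Delta>\<gamma>)(Y) = \<Sum>\<^sub>a (\<nabla>\<^sup>2\<^bsub>E\<^sub>a, E\<^sub>a\<^esub> \<gamma>)(Y)\<close>, the divergence of \<open>\<nabla>\<gamma>\<close>. By the
  Ricci identity this is the only operator for which
  \<open>div(L\<^sub>X g) = (\<Delta> + S\<^sub>\<sharp>)(X\<^sup>\<flat>) + d(div X)\<close> holds for all vector fields \<open>X\<close>; the operator
  \<open>-(d\<delta> + \<delta>d)\<close> would need \<open>2 S\<^sub>\<sharp>\<close> in place of \<open>S\<^sub>\<sharp>\<close>.\<close>

definition laplacian :: "('a, 'n::finite) tensor2 \<Rightarrow> ('a, 'n) form1 \<Rightarrow> ('a, 'n) form1" where
  "laplacian g \<gamma> = div_tensor g (nabla_form g \<gamma>)"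

section \<open>Eta-Ricci solitons and the three classes of 1-forms\<close>

definition eta_ricci_soliton ::
    "('a, 'n::finite) chart set \<Rightarrow> ('a, 'n) tensor2 \<Rightarrow> ('a, 'n) vfield \<Rightarrow> real \<Rightarrow> real \<Rightarrow> bool" where
  "eta_ricci_soliton A g \<xi> l \<mu> \<longleftrightarrow> riemannian_metric A g \<and> smooth_vfield A \<xi> \<and>
     field_eq A (\<lambda>c p. lie_deriv \<xi> g c p + 2 *\<^sub>R ricci g c p + (2 * l) *\<^sub>R g c p
                   + (2 * \<mu>) *\<^sub>R tensor_square (flat g \<xi>) c p) zero_field"

definition schrodinger_ricci_solution ::
    "('a, 'n::finite) chart set \<Rightarrow> ('a, 'n) tensor2 \<Rightarrow> ('a, 'n) form1 \<Rightarrow> bool" where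
  "schrodinger_ricci_solution A g \<gamma> \<longleftrightarrow>
     field_eq A (div_tensor g (lie_deriv (sharp g \<gamma>) g)) zero_field"

definition schrodinger_ricci_harmonic ::
    "('a, 'n::finite) chart set \<Rightarrow> ('a, 'n) tensor2 \<Rightarrow> ('a, 'n) form1 \<Rightarrow> bool" where
  "schrodinger_ricci_harmonic A g \<gamma> \<longleftrightarrow>
     field_eq A (\<lambda>c p. laplacian g \<gamma> c p + S_sharp g \<gamma> c p) zero_field"

definition harmonic_form ::
    "('a, 'n::finite) chart set \<Rightarrow> ('a, 'n) tensor2 \<Rightarrow> ('a, 'n) form1 \<Rightarrow> bool" where
  "harmonic_form A g \<gamma> \<longleftrightarrow> field_eq A (laplacian g \<gamma>) zero_field"

definition divergence_free ::
    "('a, 'n::finite) chart set \<Rightarrow> ('a, 'n) tensor2 \<Rightarrow> ('a, 'n) form1 \<Rightarrow> bool" where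
  "divergence_free A g \<gamma> \<longleftrightarrow> (\<forall>p\<in>carrier_of A. div_vfield A g (sharp g \<gamma>) p = 0)"

definition in_ker_Q ::
    "('a, 'n::finite) chart set \<Rightarrow> ('a, 'n) tensor2 \<Rightarrow> ('a, 'n) vfield \<Rightarrow> bool" where
  "in_ker_Q A g X \<longleftrightarrow> field_eq A (ricci_op g X) zero_field"

section \<open>Consistency of the component definitions\<close>

lemma matrix_inv_works:
  fixes A B :: "real^'n^'n"
  assumes "A ** B = mat 1" "B ** A = mat 1"
  shows "A ** matrix_inv A = mat 1" "matrix_inv A ** A = mat 1" "matrix_inv A = B"
proof -
  have *: "A ** matrix_inv A = mat 1 \<and> matrix_inv A ** A = mat 1"
    unfolding matrix_inv_def by (rule someI[of _ B]) (use assms in simp)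
  thus "A ** matrix_inv A = mat 1" "matrix_inv A ** A = mat 1"
    by auto
  have "matrix_inv A = (matrix_inv A ** A) ** B"
    using assms(1) by (simp flip: matrix_mul_assoc)
  thus "matrix_inv A = B"
    using * by simp
qed

lemma metric_trace_orthonormal:
  fixes G B :: "real^'n^'n" and E :: "'n \<Rightarrow> real^'n"
  assumes "\<And>a b. E a \<bullet> (G *v E b) = (if a = b then 1 else 0)"
  shows "metric_trace G B = (\<Sum>a\<in>UNIV. E a \<bullet> (B *v E a))"
proof -
  define P :: "real^'n^'n" where "P = (\<chi> i a. E a $ i)"
  have "transpose P ** (G ** P) = mat 1"
    using assms
    by (simp add: vec_eq_iff matrix_matrix_mult_def transpose_def P_def mat_def inner_vec_def
        matrix_vector_mult_def)
  hence "(G ** P) ** transpose P = mat 1"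
    using matrix_left_right_inverse by blast
  hence 1: "G ** (P ** transpose P) = mat 1"
    by (simp add: matrix_mul_assoc)
  hence 2: "(P ** transpose P) ** G = mat 1"
    using matrix_left_right_inverse by blast
  have "matrix_inv G = P ** transpose P"
    using 1 2 by (rule matrix_inv_works(3))
  hence "matrix_inv G $ i $ j = (\<Sum>a\<in>UNIV. E a $ i * E a $ j)" for i j
    by (simp add: matrix_matrix_mult_def transpose_def P_def)
  hence "metric_trace G B = (\<Sum>i\<in>UNIV. \<Sum>j\<in>UNIV. \<Sum>a\<in>UNIV. E a $ i * E a $ j * B $ i $ j)"
    by (simp add: metric_trace_def sum_distrib_right)
  also have "\<dots> = (\<Sum>i\<in>UNIV. \<Sum>a\<in>UNIV. \<Sum>j\<in>UNIV. E a $ i * E a $ j * B $ i $ j)"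
    by (intro sum.cong refl sum.swap)
  also have "\<dots> = (\<Sum>a\<in>UNIV. \<Sum>i\<in>UNIV. \<Sum>j\<in>UNIV. E a $ i * E a $ j * B $ i $ j)"
    by (rule sum.swap)
  also have "\<dots> = (\<Sum>a\<in>UNIV. E a \<bullet> (B *v E a))"
    by (simp add: inner_vec_def matrix_vector_mult_def sum_distrib_left ac_simps)
  finally show ?thesis .
qed

lemma pd_cong:
  assumes "is_chart c" "p \<in> fst c" "\<And>q. q \<in> fst c \<Longrightarrow> f q = h q"
  shows "pd c i f p = pd c i h p"
proof -
  have o: "open (snd c ` fst c)" and x: "snd c p \<in> snd c ` fst c"
    using assms by (auto simp: is_chart_def)
  have eq: "(f \<circ> chart_inv c) y = (h \<circ> chart_inv c) y" if "y \<in> snd c ` fst c" for y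
    using that assms(3) by (simp add: chart_inv_def inv_into_into)
  have "((f \<circ> chart_inv c) has_derivative D) (at (snd c p)) \<longleftrightarrow>
        ((h \<circ> chart_inv c) has_derivative D) (at (snd c p))" for D
    using has_derivative_transform_within_open[OF _ o x, of "f \<circ> chart_inv c" D UNIV "h \<circ> chart_inv c"]
      has_derivative_transform_within_open[OF _ o x, of "h \<circ> chart_inv c" D UNIV "f \<circ> chart_inv c"] eq
    by auto
  thus ?thesis
    by (simp add: pd_def partial_def frechet_derivative_def)
qed

lemma riemannian_metric_sym:
  assumes "riemannian_metric A g" "c \<in> A" "p \<in> fst c"
  shows "g c p $ i $ j = g c p $ j $ i"
proof -
  have "transpose (g c p) $ i $ j = g c p $ i $ j"
    using assms by (simp add: riemannian_metric_def)
  thus ?thesis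
    by (simp add: transpose_def)
qed

lemma riemannian_metric_inverse:
  assumes "riemannian_metric A g" "c \<in> A" "p \<in> fst c"
  shows "g c p ** matrix_inv (g c p) = mat 1" "matrix_inv (g c p) ** g c p = mat 1"
proof -
  have "\<forall>x. g c p *v x = 0 \<longrightarrow> x = 0"
    using assms unfolding riemannian_metric_def by (metis inner_zero_right less_irrefl)
  then obtain B where B: "B ** g c p = mat 1"
    by (metis matrix_left_invertible_ker)
  hence "g c p ** B = mat 1"
    using matrix_left_right_inverse by blast
  thus "g c p ** matrix_inv (g c p) = mat 1" "matrix_inv (g c p) ** g c p = mat 1"
    using matrix_inv_works(1,2) B by blast+
qed

lemma christoffel_symmetric:
  assumes "smooth_manifold A" "riemannian_metric A g" "c \<in> A" "p \<in> fst c"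
  shows "christoffel g c k i j p = christoffel g c k j i p"
proof -
  have "pd c l (\<lambda>q. g c q $ i $ j) p = pd c l (\<lambda>q. g c q $ j $ i) p" for l
    using assms by (intro pd_cong) (auto simp: smooth_manifold_def intro: riemannian_metric_sym)
  thus ?thesis
    by (simp add: christoffel_def add.commute)
qed

lemma levi_civita_metric:
  assumes "smooth_manifold A" "riemannian_metric A g" "c \<in> A" "p \<in> fst c"
  shows "nabla_tensor g g c p k = 0"
proof -
  define D where "D i j l = pd c i (\<lambda>q. g c q $ j $ l) p" for i j l
  have Dsym: "D l i j = D l j i" for l i j
    unfolding D_def using assms
    by (intro pd_cong) (auto simp: smooth_manifold_def intro: riemannian_metric_sym)
  have inv: "(\<Sum>l\<in>UNIV. g c p $ j $ l * matrix_inv (g c p) $ l $ m) = (if j = m then 1 else 0)"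
    for j m
    using arg_cong[OF riemannian_metric_inverse(1)[OF assms(2-4)], of "\<lambda>M. M $ j $ m"]
    by (simp add: matrix_matrix_mult_def mat_def)
  have low: "(\<Sum>l\<in>UNIV. christoffel g c l k i p * g c p $ j $ l)
      = (1/2) * (D k i j + D i k j - D j k i)" for i j
  proof -
    have "(\<Sum>l\<in>UNIV. christoffel g c l k i p * g c p $ j $ l) =
      (\<Sum>l\<in>UNIV. \<Sum>m\<in>UNIV. (1/2) * (g c p $ j $ l * matrix_inv (g c p) $ l $ m)
          * (D k i m + D i k m - D m k i))"
      by (simp add: christoffel_def D_def sum_distrib_left sum_distrib_right mult_ac)
    also have "\<dots> = (\<Sum>m\<in>UNIV. \<Sum>l\<in>UNIV. (1/2) * (g c p $ j $ l * matrix_inv (g c p) $ l $ m)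
          * (D k i m + D i k m - D m k i))"
      by (rule sum.swap)
    also have "\<dots> = (\<Sum>m\<in>UNIV. (1/2) * (if j = m then 1 else 0) * (D k i m + D i k m - D m k i))"
      by (simp only: sum_distrib_left[symmetric] sum_distrib_right[symmetric] inv)
    also have "\<dots> = (\<Sum>m\<in>UNIV. if j = m then (1/2) * (D k i m + D i k m - D m k i) else 0)"
      by (intro sum.cong) auto
    also have "\<dots> = (1/2) * (D k i j + D i k j - D j k i)"
      by simp
    finally show ?thesis .
  qed
  have "nabla_tensor g g c p k $ i $ j = 0" for i j
  proof -
    have "(\<Sum>l\<in>UNIV. christoffel g c l k i p * g c p $ l $ j)
        = (\<Sum>l\<in>UNIV. christoffel g c l k i p * g c p $ j $ l)"
      using riemannian_metric_sym[OF assms(2-4)] by (intro sum.cong) auto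
    hence "nabla_tensor g g c p k $ i $ j
        = D k i j - (1/2) * (D k i j + D i k j - D j k i) - (1/2) * (D k j i + D j k i - D i k j)"
      by (simp add: nabla_tensor_def low D_def)
    thus ?thesis
      using Dsym[of k i j] by (simp add: field_simps)
  qed
  thus ?thesis
    by (simp add: vec_eq_iff)
qed

end

theory Submission
  imports Defs
begin

text \<open>The contracted Ricci identity \<open>\<nabla>\<^sub>i \<nabla>\<^sub>k \<xi>\<^sup>i = \<nabla>\<^sub>k (div \<xi>) + S\<^sub>k\<^sub>m \<xi>\<^sup>m\<close> gives
  \<open>div(L\<^sub>\<xi> g) = \<Delta>\<eta> + S\<^sub>\<sharp>(\<eta>) + d(div \<xi>)\<close>, and the trace of the soliton equation reads
  \<open>div \<xi> + scal + \<mu> |\<xi>|\<^sup>2 + l n = 0\<close>. Hence \<open>div(L\<^sub>\<xi> g) = \<Delta>\<eta> + S\<^sub>\<sharp>(\<eta>) - d(scal + \<mu> |\<xi>|\<^sup>2)\<close>. Each class of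
  1-forms asserts that one part of this identity vanishes, \<open>S\<^sub>\<sharp>(\<eta>) = (Q\<xi>)\<^sup>\<flat>\<close>, and a harmonic \<open>\<eta>\<close> is
  divergence free, so that \<open>d(scal + \<mu> |\<xi>|\<^sup>2) = 0\<close>.\<close>

section \<open>Partial derivatives\<close>

text \<open>\<open>scal\<close>, \<open>norm_sq\<close> and \<open>div_vfield\<close> are read at
  each point \<open>p\<close> in the chart \<open>chart_at A p\<close>, which may jump from point to
  point, so as they stand they cannot be differentiated in a fixed chart. Comparing curvature in two
  charts would involve second derivatives of the metric and third derivatives of the transition map.
  The trace of the soliton equation, taken at \<open>p\<close> in that very chart, trades scal +
  \<mu> |\<xi>|^2 for -div \<xi> - l n. The comparison of charts then concerns div \<xi> alone,
  hence first derivatives of g and \<xi> and second derivatives of the transition map.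
  Differentiability of the potential comes from the same formula. The contracted Ricci identity
  rests on commuting second partial derivatives of the components of \<xi> and on the symmetry of
  the Christoffel symbols; metric compatibility then moves g through the covariant
  derivatives.\<close>

lemma partial_eq:
  assumes "(f has_derivative D) (at x)"
  shows "partial i f x = D (axis i 1)"
  using frechet_derivative_at[OF assms] by (simp add: partial_def)

lemma partial_cong:
  assumes "open U" "x \<in> U" "\<And>y. y \<in> U \<Longrightarrow> f y = h y"
  shows "partial i f x = partial i h x"
proof -
  have "(f has_derivative D) (at x) \<longleftrightarrow> (h has_derivative D) (at x)" for D
    using has_derivative_transform_within_open[OF _ assms(1,2), of f D UNIV h]
      has_derivative_transform_within_open[OF _ assms(1,2), of h D UNIV f] assms(3)
    by auto
  thus ?thesis
    by (simp add: partial_def frechet_derivative_def)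
qed

lemma differentiable_transform_open:
  fixes f h :: "'a::real_normed_vector \<Rightarrow> 'b::real_normed_vector"
  assumes "f differentiable (at x)" "open U" "x \<in> U" "\<And>y. y \<in> U \<Longrightarrow> f y = h y"
  shows "h differentiable (at x)"
  using assms has_derivative_transform_within_open[OF _ assms(2,3), of f _ UNIV h]
  unfolding differentiable_def by blast

text \<open>Restriction to a coordinate line, so that the one-variable mean value theorem becomes
  applicable.\<close>

lemma partial_line:
  fixes f :: "real^'n \<Rightarrow> real"
  assumes "f differentiable (at (y + s *\<^sub>R axis i 1))"
  shows "((\<lambda>s. f (y + s *\<^sub>R axis i 1)) has_real_derivative partial i f (y + s *\<^sub>R axis i 1)) (at s)"
proof -
  let ?D = "frechet_derivative f (at (y + s *\<^sub>R axis i 1))"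
  have D: "(f has_derivative ?D) (at (y + s *\<^sub>R axis i 1))"
    using assms frechet_derivative_works by blast
  have L: "((\<lambda>s. y + s *\<^sub>R axis i 1) has_derivative (\<lambda>h. h *\<^sub>R axis i 1)) (at s)"
    by (auto intro!: derivative_eq_intros)
  have "(\<lambda>h. ?D (h *\<^sub>R axis i 1)) = (*) (?D (axis i 1))"
    using linear_scale[OF has_derivative_linear[OF D]] by (auto simp: mult.commute)
  with has_derivative_compose[OF L, of f ?D] D show ?thesis
    by (simp add: has_field_derivative_def partial_def)
qed

text \<open>Two uses of the mean value theorem: on the increment of \<open>f\<close> in direction j,
  as a function of the step in direction i, and then on \<open>partial i f\<close> along direction
  j. The left-hand side is symmetric in i and j while the right-hand side is not, which is what
  forces mixed derivatives to agree. All points used have the form x + a u + b v with a, b in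
  [0, t], hence the radius 2 t.\<close>

lemma second_difference:
  fixes f :: "real^'n \<Rightarrow> real"
  assumes f: "\<And>y. y \<in> ball x r \<Longrightarrow> f differentiable (at y)"
    and fi: "\<And>y. y \<in> ball x r \<Longrightarrow> partial i f differentiable (at y)"
    and t: "0 < t" "2 * t < r"
  obtains y where "dist x y \<le> 2 * t"
    "f (x + t *\<^sub>R axis i 1 + t *\<^sub>R axis j 1) - f (x + t *\<^sub>R axis i 1) - f (x + t *\<^sub>R axis j 1) + f x
       = t\<^sup>2 * partial j (partial i f) y"
proof -
  define u v :: "real^'n" where "u = axis i 1" and "v = axis j 1"
  have nm: "norm (a *\<^sub>R u + b *\<^sub>R v) \<le> 2 * t" if "0 \<le> a" "a \<le> t" "0 \<le> b" "b \<le> t" for a b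
    using norm_triangle_ineq[of "a *\<^sub>R u" "b *\<^sub>R v"] that by (simp add: u_def v_def)
  have near: "dist x (x + a *\<^sub>R u + b *\<^sub>R v) \<le> 2 * t" if "0 \<le> a" "a \<le> t" "0 \<le> b" "b \<le> t" for a b
  proof -
    have "dist x (x + a *\<^sub>R u + b *\<^sub>R v) = norm (a *\<^sub>R u + b *\<^sub>R v)"
      by (metis add.assoc add_diff_cancel_left' dist_commute dist_norm)
    thus ?thesis using nm[OF that] by simp
  qed
  have inball: "x + a *\<^sub>R u + b *\<^sub>R v \<in> ball x r" if "0 \<le> a" "a \<le> t" "0 \<le> b" "b \<le> t" for a b
    using near[OF that] t by simp
  define \<phi> where "\<phi> s = f (x + s *\<^sub>R u + t *\<^sub>R v) - f (x + s *\<^sub>R u)" for s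
  have d\<phi>: "(\<phi> has_real_derivative partial i f (x + s *\<^sub>R u + t *\<^sub>R v) - partial i f (x + s *\<^sub>R u)) (at s)"
    if "0 \<le> s" "s \<le> t" for s
  proof -
    have 1: "f differentiable (at ((x + t *\<^sub>R v) + s *\<^sub>R axis i 1))"
      using f[OF inball[of s t]] that t by (simp add: u_def add_ac)
    have 2: "f differentiable (at (x + s *\<^sub>R axis i 1))"
      using f[OF inball[of s 0]] that t by (simp add: u_def)
    show ?thesis
      using DERIV_diff[OF partial_line[OF 1] partial_line[OF 2]]
      unfolding \<phi>_def by (simp add: u_def add_ac)
  qed
  obtain \<theta> where \<theta>: "0 < \<theta>" "\<theta> < t"
    "\<phi> t - \<phi> 0 = (t - 0) * (partial i f (x + \<theta> *\<^sub>R u + t *\<^sub>R v) - partial i f (x + \<theta> *\<^sub>R u))"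
    using MVT2[OF t(1) d\<phi>] by auto
  have d\<psi>: "((\<lambda>s. partial i f ((x + \<theta> *\<^sub>R u) + s *\<^sub>R v)) has_real_derivative
      partial j (partial i f) ((x + \<theta> *\<^sub>R u) + s *\<^sub>R v)) (at s)" if "0 \<le> s" "s \<le> t" for s
    unfolding v_def
    using fi[OF inball[of \<theta> s]] that \<theta> by (intro partial_line) (simp add: v_def)
  obtain \<theta>' where \<theta>': "0 < \<theta>'" "\<theta>' < t"
    "partial i f ((x + \<theta> *\<^sub>R u) + t *\<^sub>R v) - partial i f ((x + \<theta> *\<^sub>R u) + 0 *\<^sub>R v)
      = (t - 0) * partial j (partial i f) ((x + \<theta> *\<^sub>R u) + \<theta>' *\<^sub>R v)"
    using MVT2[OF t(1) d\<psi>] by auto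
  show ?thesis
  proof (rule that)
    show "dist x (x + \<theta> *\<^sub>R u + \<theta>' *\<^sub>R v) \<le> 2 * t"
      using near \<theta> \<theta>' by simp
    show "f (x + t *\<^sub>R axis i 1 + t *\<^sub>R axis j 1) - f (x + t *\<^sub>R axis i 1) - f (x + t *\<^sub>R axis j 1) + f x
       = t\<^sup>2 * partial j (partial i f) (x + \<theta> *\<^sub>R u + \<theta>' *\<^sub>R v)"
      using \<theta>(3) \<theta>'(3) by (simp add: \<phi>_def u_def v_def power2_eq_square)
  qed
qed

text \<open>The symmetric second difference gives equal mixed derivatives at two nearby points
  \<open>y1\<close> and \<open>y2\<close>. With \<open>e\<close> half the supposed gap at x,
  continuity puts each of the two values within \<open>e\<close> of its value at x, so the gap would
  be less than 2 e, that is, less than itself.\<close>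

lemma partial_commute:
  fixes f :: "real^'n \<Rightarrow> real"
  assumes U: "open U" "x \<in> U" and f: "Ck_on 2 U f"
  shows "partial i (partial j f) x = partial j (partial i f) x"
proof (rule ccontr)
  have fd: "f differentiable (at y)" and fid: "partial k f differentiable (at y)"
    if "y \<in> U" for y k
    using f that U(1) by (auto simp: numeral_2_eq_2 differentiable_on_eq_differentiable_at)
  have cont: "continuous (at x) (partial k (partial m f))" for k m
    using f U by (auto simp: numeral_2_eq_2 continuous_on_eq_continuous_at)
  assume ne: "\<not> ?thesis"
  define e where "e = \<bar>partial i (partial j f) x - partial j (partial i f) x\<bar> / 2"
  have e: "0 < e" using ne by (simp add: e_def)
  have "\<exists>d>0. \<forall>y. dist y x < d \<longrightarrow> dist (partial k (partial m f) y) (partial k (partial m f) x) < e" for k m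
    using cont[of k m] e unfolding continuous_at_eps_delta by blast
  then obtain d1 d2 where d: "0 < d1" "0 < d2"
    "\<And>y. dist y x < d1 \<Longrightarrow> dist (partial i (partial j f) y) (partial i (partial j f) x) < e"
    "\<And>y. dist y x < d2 \<Longrightarrow> dist (partial j (partial i f) y) (partial j (partial i f) x) < e"
    by metis
  obtain r where r: "0 < r" "ball x r \<subseteq> U"
    using U openE by blast
  \<comment> \<open>The factor 1/3 makes 2 t strictly smaller than all three radii, and the
    intermediate points lie within 2 t of x.\<close>
  define t where "t = min r (min d1 d2) / 3"
  have t: "0 < t" "2 * t < r" "2 * t < d1" "2 * t < d2"
    using r d by (auto simp: t_def)
  obtain y1 where y1: "dist x y1 \<le> 2 * t"
    "f (x + t *\<^sub>R axis i 1 + t *\<^sub>R axis j 1) - f (x + t *\<^sub>R axis i 1) - f (x + t *\<^sub>R axis j 1) + f x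
       = t\<^sup>2 * partial j (partial i f) y1"
    using second_difference[of x r f i t j] fd fid r t by blast
  obtain y2 where y2: "dist x y2 \<le> 2 * t"
    "f (x + t *\<^sub>R axis j 1 + t *\<^sub>R axis i 1) - f (x + t *\<^sub>R axis j 1) - f (x + t *\<^sub>R axis i 1) + f x
       = t\<^sup>2 * partial i (partial j f) y2"
    using second_difference[of x r f j t i] fd fid r t by blast
  have "t\<^sup>2 * partial j (partial i f) y1 = t\<^sup>2 * partial i (partial j f) y2"
    using y1(2) y2(2) by (simp add: algebra_simps)
  hence "partial j (partial i f) y1 = partial i (partial j f) y2"
    using t(1) by simp
  moreover have "dist (partial i (partial j f) y2) (partial i (partial j f) x) < e"
    by (rule d(3)) (use y2(1) t in \<open>simp add: dist_commute\<close>)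
  moreover have "dist (partial j (partial i f) y1) (partial j (partial i f) x) < e"
    by (rule d(4)) (use y1(1) t in \<open>simp add: dist_commute\<close>)
  ultimately show False
    unfolding e_def dist_real_def by (simp add: field_simps abs_if split: if_splits)
qed

section \<open>Differentiability of determinants and of the inverse matrix\<close>

lemma matrix_inv_nth_Cramer:
  fixes M :: "real^'n^'n"
  assumes "det M \<noteq> 0"
  shows "matrix_inv M $ i $ j = det (\<chi> a b. if b = i then axis j 1 $ a else M $ a $ b) / det M"
proof -
  obtain B where "M ** B = mat 1" "B ** M = mat 1"
    using assms invertible_det_nz[of M] unfolding invertible_def by blast
  hence "M *v (matrix_inv M *v axis j 1) = axis j 1"
    by (simp add: matrix_vector_mul_assoc matrix_inv_works(1))
  hence "matrix_inv M *v axis j 1 = (\<chi> k. det (\<chi> a b. if b = k then axis j 1 $ a else M $ a $ b) / det M)"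
    using cramer[OF assms] by blast
  hence "(matrix_inv M *v axis j 1) $ i = det (\<chi> a b. if b = i then axis j 1 $ a else M $ a $ b) / det M"
    by simp
  thus ?thesis
    by (simp add: matrix_vector_mul_component inner_axis)
qed

lemma differentiable_det:
  fixes F :: "'b::real_normed_vector \<Rightarrow> real^'n^'n"
  assumes "\<And>i j. (\<lambda>x. F x $ i $ j) differentiable (at x)"
  shows "(\<lambda>x. det (F x)) differentiable (at x)"
proof -
  have "(\<lambda>x. F x $ i $ j) differentiable (at x)" for i j
    by (rule assms)
  then obtain D where D: "\<And>i j. ((\<lambda>x. F x $ i $ j) has_derivative D i j) (at x)"
    unfolding differentiable_def by metis
  have "(\<lambda>x. \<Prod>i\<in>UNIV. F x $ i $ p i) differentiable (at x)" for p
    unfolding differentiable_def by (rule exI, rule has_derivative_prod, rule D)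
  thus ?thesis
    unfolding det_def by (intro differentiable_sum differentiable_mult) auto
qed

text \<open>By Cramer's rule an entry of the inverse is a quotient of two determinants, and these
  are polynomial in the entries. The quotient agrees with \<open>matrix_inv\<close> where the
  determinant is nonzero, hence the open set \<open>U\<close>.\<close>

lemma differentiable_matrix_inv:
  fixes F :: "'b::real_normed_vector \<Rightarrow> real^'n^'n"
  assumes F: "\<And>i j. (\<lambda>x. F x $ i $ j) differentiable (at x)"
    and U: "open U" "x \<in> U" "\<And>y. y \<in> U \<Longrightarrow> det (F y) \<noteq> 0"
  shows "(\<lambda>x. matrix_inv (F x) $ i $ j) differentiable (at x)"
proof (rule differentiable_transform_open[OF _ U(1,2)])
  let ?N = "\<lambda>x. (\<chi> a b. if b = i then axis j 1 $ a else F x $ a $ b) :: real^'n^'n"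
  have "(\<lambda>x. ?N x $ a $ b) differentiable (at x)" for a b
    using F by (cases "b = i") auto
  thus "(\<lambda>x. det (?N x) / det (F x)) differentiable (at x)"
    using U by (intro differentiable_divide differentiable_det F) auto
  show "det (?N y) / det (F y) = matrix_inv (F y) $ i $ j" if "y \<in> U" for y
    using matrix_inv_nth_Cramer[OF U(3)[OF that]] by simp
qed

section \<open>Calculus in a chart\<close>

text \<open>\<open>pd\<close> goes through \<open>frechet_derivative\<close>, a choice operator that
  carries no information where no derivative exists. The sum and product rules for \<open>pd\<close>
  therefore take this predicate as a premise.\<close>

definition differentiable_in :: "('a, 'n::finite) chart \<Rightarrow> ('a \<Rightarrow> real) \<Rightarrow> 'a \<Rightarrow> bool" where
  "differentiable_in c f p \<longleftrightarrow> (f \<circ> chart_inv c) differentiable (at (snd c p))"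

lemma chart_inv_left:
  assumes "is_chart c" "p \<in> fst c"
  shows "chart_inv c (snd c p) = p"
  using assms unfolding is_chart_def homeomorphism_def by blast

lemma chart_inv_right:
  assumes "is_chart c" "y \<in> snd c ` fst c"
  shows "snd c (chart_inv c y) = y" "chart_inv c y \<in> fst c"
  using assms unfolding is_chart_def homeomorphism_def by blast+

lemma chart_image_open:
  assumes "is_chart c" "open W" "W \<subseteq> fst c"
  shows "open (snd c ` W)"
proof -
  have "homeomorphism (fst c) (snd c ` fst c) (snd c) (chart_inv c)" "open (snd c ` fst c)"
    using assms(1) by (auto simp: is_chart_def)
  thus ?thesis
    using homeomorphism_imp_open_map[of "fst c" "snd c ` fst c" "snd c" "chart_inv c" W] assms(2,3)
    by (metis open_openin_trans open_subset openin_open_eq openin_open_trans)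
qed

lemma differentiable_in_const [simp]: "differentiable_in c (\<lambda>q. a) p"
  by (simp add: differentiable_in_def o_def)

lemma differentiable_in_add [intro]:
  "differentiable_in c f p \<Longrightarrow> differentiable_in c h p \<Longrightarrow> differentiable_in c (\<lambda>q. f q + h q) p"
  unfolding differentiable_in_def o_def by (rule differentiable_add)

lemma differentiable_in_diff [intro]:
  "differentiable_in c f p \<Longrightarrow> differentiable_in c h p \<Longrightarrow> differentiable_in c (\<lambda>q. f q - h q) p"
  unfolding differentiable_in_def o_def by (rule differentiable_diff)

lemma differentiable_in_mult [intro]:
  "differentiable_in c f p \<Longrightarrow> differentiable_in c h p \<Longrightarrow> differentiable_in c (\<lambda>q. f q * h q) p"
  unfolding differentiable_in_def o_def by (rule differentiable_mult)

lemma differentiable_in_sum [intro]: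
  "(\<And>s. s \<in> S \<Longrightarrow> differentiable_in c (f s) p) \<Longrightarrow> finite S \<Longrightarrow> differentiable_in c (\<lambda>q. \<Sum>s\<in>S. f s q) p"
  unfolding differentiable_in_def o_def by (rule differentiable_sum) auto

lemma differentiable_in_cong:
  assumes "is_chart c" "open W" "p \<in> W" "W \<subseteq> fst c" "\<And>q. q \<in> W \<Longrightarrow> f q = h q"
    "differentiable_in c f p"
  shows "differentiable_in c h p"
  unfolding differentiable_in_def
proof (rule differentiable_transform_open)
  show "(f \<circ> chart_inv c) differentiable (at (snd c p))"
    using assms(6) by (simp add: differentiable_in_def)
  show "open (snd c ` W)"
    using assms by (intro chart_image_open)
  fix y assume "y \<in> snd c ` W"
  thus "(f \<circ> chart_inv c) y = (h \<circ> chart_inv c) y"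
    using assms(1,4,5) by (auto simp: chart_inv_left subset_eq)
qed (use assms in auto)

text \<open>Unlike \<open>pd_cong\<close>, agreement on an open part of the chart domain is enough:
  transformation laws hold on the overlap of two charts.\<close>

lemma pd_cong_open:
  assumes "is_chart c" "open W" "p \<in> W" "W \<subseteq> fst c" "\<And>q. q \<in> W \<Longrightarrow> f q = h q"
  shows "pd c i f p = pd c i h p"
  unfolding pd_def
proof (rule partial_cong)
  show "open (snd c ` W)"
    using assms by (intro chart_image_open)
  fix y assume "y \<in> snd c ` W"
  thus "(f \<circ> chart_inv c) y = (h \<circ> chart_inv c) y"
    using assms(1,4,5) by (auto simp: chart_inv_left subset_eq)
qed (use assms in auto)

lemma pd_const [simp]: "pd c i (\<lambda>q. a) p = 0"
  unfolding pd_def o_def by (rule partial_eq) (rule has_derivative_const)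

lemma pd_works:
  assumes "differentiable_in c f p"
  shows "\<exists>D. (f \<circ> chart_inv c has_derivative D) (at (snd c p)) \<and> pd c i f p = D (axis i 1)"
  using assms frechet_derivative_works unfolding differentiable_in_def pd_def partial_def by blast

lemma pd_add:
  assumes "differentiable_in c f p" "differentiable_in c h p"
  shows "pd c i (\<lambda>q. f q + h q) p = pd c i f p + pd c i h p"
proof -
  obtain D E where D: "(f \<circ> chart_inv c has_derivative D) (at (snd c p))" "pd c i f p = D (axis i 1)"
    and E: "(h \<circ> chart_inv c has_derivative E) (at (snd c p))" "pd c i h p = E (axis i 1)"
    using assms pd_works by metis
  show ?thesis
    using partial_eq[OF has_derivative_add[OF D(1) E(1)], of i] D(2) E(2) by (simp add: pd_def o_def)
qed

lemma pd_diff: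
  assumes "differentiable_in c f p" "differentiable_in c h p"
  shows "pd c i (\<lambda>q. f q - h q) p = pd c i f p - pd c i h p"
proof -
  obtain D E where D: "(f \<circ> chart_inv c has_derivative D) (at (snd c p))" "pd c i f p = D (axis i 1)"
    and E: "(h \<circ> chart_inv c has_derivative E) (at (snd c p))" "pd c i h p = E (axis i 1)"
    using assms pd_works by metis
  show ?thesis
    using partial_eq[OF has_derivative_diff[OF D(1) E(1)], of i] D(2) E(2) by (simp add: pd_def o_def)
qed

lemma pd_mult:
  assumes "is_chart c" "p \<in> fst c" "differentiable_in c f p" "differentiable_in c h p"
  shows "pd c i (\<lambda>q. f q * h q) p = f p * pd c i h p + pd c i f p * h p"
proof -
  obtain D E where D: "(f \<circ> chart_inv c has_derivative D) (at (snd c p))" "pd c i f p = D (axis i 1)"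
    and E: "(h \<circ> chart_inv c has_derivative E) (at (snd c p))" "pd c i h p = E (axis i 1)"
    using assms pd_works by metis
  show ?thesis
    using partial_eq[OF has_derivative_mult[OF D(1) E(1)], of i] D(2) E(2) assms(1,2)
    by (simp add: pd_def o_def chart_inv_left)
qed

lemma pd_sum:
  assumes "\<And>s. s \<in> S \<Longrightarrow> differentiable_in c (f s) p" "finite S"
  shows "pd c i (\<lambda>q. \<Sum>s\<in>S. f s q) p = (\<Sum>s\<in>S. pd c i (f s) p)"
  using assms(2,1)
proof (induction S rule: finite_induct)
  case (insert s S)
  thus ?case
    using pd_add[of c "f s" p "\<lambda>q. \<Sum>s\<in>S. f s q" i] by (simp add: differentiable_in_sum)
qed simp

lemma differentiable_in_matrix_inv:
  fixes F :: "'a::topological_space \<Rightarrow> real^'m^'m"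
  assumes c: "is_chart c" "p \<in> fst c"
    and F: "\<And>i j. differentiable_in c (\<lambda>q. F q $ i $ j) p" "\<And>q. q \<in> fst c \<Longrightarrow> det (F q) \<noteq> 0"
  shows "differentiable_in c (\<lambda>q. matrix_inv (F q) $ i $ j) p"
  unfolding differentiable_in_def o_def
proof (rule differentiable_matrix_inv)
  show "(\<lambda>x. F (chart_inv c x) $ i $ j) differentiable (at (snd c p))" for i j
    using F(1) by (simp add: differentiable_in_def o_def)
  show "open (snd c ` fst c)" using c(1) by (simp add: is_chart_def)
  show "det (F (chart_inv c y)) \<noteq> 0" if "y \<in> snd c ` fst c" for y
    using F(2) chart_inv_right(2)[OF c(1) that] by blast
qed (use c in auto)

text \<open>Stated for an open \<open>W\<close> inside the domain because it serves both for
  components of tensor fields, with \<open>W\<close> the whole domain, and for transition functions,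
  which are smooth on the overlap.\<close>

lemma smooth_on_pd:
  fixes c :: "('a::topological_space, 'n::finite) chart"
  assumes c: "is_chart c" and W: "open W" "W \<subseteq> fst c" "p \<in> W"
    and f: "smooth_on (snd c ` W) (f \<circ> chart_inv c)"
  shows "differentiable_in c f p" "differentiable_in c (pd c i f) p"
    "pd c i (pd c j f) p = pd c j (pd c i f) p"
proof -
  let ?V = "snd c ` W"
  have V: "open ?V" "snd c p \<in> ?V"
    using chart_image_open[OF c W(1,2)] W by auto
  have eq: "partial k (f \<circ> chart_inv c) y = (pd c k f \<circ> chart_inv c) y" if "y \<in> ?V" for y k
    using that W(2) chart_inv_left[OF c] by (auto simp: pd_def o_def)
  have f2: "Ck_on 2 ?V (f \<circ> chart_inv c)"
    using f by (simp add: smooth_on_def)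
  thus "differentiable_in c f p"
    using V by (auto simp: numeral_2_eq_2 differentiable_in_def differentiable_on_eq_differentiable_at)
  have "partial i (f \<circ> chart_inv c) differentiable (at (snd c p))"
    using f2 V by (auto simp: numeral_2_eq_2 differentiable_on_eq_differentiable_at)
  thus "differentiable_in c (pd c i f) p"
    unfolding differentiable_in_def by (rule differentiable_transform_open[OF _ V eq])
  have "pd c k (pd c m f) p = partial k (partial m (f \<circ> chart_inv c)) (snd c p)" for k m
    unfolding pd_def[of c k "pd c m f"] by (rule partial_cong[OF V, symmetric]) (rule eq)
  thus "pd c i (pd c j f) p = pd c j (pd c i f) p"
    using partial_commute[OF V f2, of i j] by simp
qed

section \<open>The Levi-Civita connection in a chart\<close>

text \<open>Entry i, k is the k-th component of the covariant derivative in direction i. This is a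
  (1,1)-tensor that merely shares the type \<open>tensor2\<close>; its plain matrix trace is the
  divergence.\<close>

definition nabla_vfield :: "('a, 'n::finite) tensor2 \<Rightarrow> ('a, 'n) vfield \<Rightarrow> ('a, 'n) tensor2" where
  "nabla_vfield g X c p = (\<chi> i k. pd c i (\<lambda>q. X c q $ k) p
      + (\<Sum>m\<in>UNIV. christoffel g c k i m p * X c p $ m))"

lemma sum_delta_mult [simp]:
  fixes f :: "'n::finite \<Rightarrow> real"
  shows "(\<Sum>m\<in>UNIV. f m * (if m = j then 1 else 0)) = f j"
  by (simp add: if_distrib cong: if_cong)

lemma metric_trace_add: "metric_trace G (B + C) = metric_trace G B + metric_trace G C"
  by (simp add: metric_trace_def algebra_simps sum.distrib)

lemma metric_trace_scaleR: "metric_trace G (a *\<^sub>R B) = a * metric_trace G B"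
  by (simp add: metric_trace_def sum_distrib_left mult_ac)

locale riemannian_chart =
  fixes A :: "('a::{t2_space, second_countable_topology}, 'n::finite) chart set"
    and g :: "('a, 'n) tensor2" and c :: "('a, 'n) chart"
  assumes manifold: "smooth_manifold A" and metric: "riemannian_metric A g" and c: "c \<in> A"
begin

lemma chart: "is_chart c"
  using manifold c by (simp add: smooth_manifold_def)

lemma dom_open: "open (fst c)"
  using chart by (simp add: is_chart_def)

lemma g_sym: "p \<in> fst c \<Longrightarrow> g c p $ i $ j = g c p $ j $ i"
  using riemannian_metric_sym[OF metric c] by blast

lemma g_inv:
  assumes "p \<in> fst c"
  shows "(\<Sum>l\<in>UNIV. g c p $ i $ l * matrix_inv (g c p) $ l $ j) = (if i = j then 1 else 0)"
    "(\<Sum>l\<in>UNIV. matrix_inv (g c p) $ i $ l * g c p $ l $ j) = (if i = j then 1 else 0)"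
  using riemannian_metric_inverse[OF metric c assms]
  by (auto simp: matrix_matrix_mult_def mat_def vec_eq_iff)

lemma g_inv_sym:
  assumes "p \<in> fst c"
  shows "matrix_inv (g c p) $ i $ j = matrix_inv (g c p) $ j $ i"
proof -
  let ?G = "g c p" and ?H = "matrix_inv (g c p)"
  note inv = riemannian_metric_inverse[OF metric c assms]
  have t: "transpose ?G = ?G"
    using metric c assms by (simp add: riemannian_metric_def)
  have "transpose ?H ** ?G = mat 1" "?G ** transpose ?H = mat 1"
    using inv by (metis matrix_transpose_mul t transpose_mat)+
  hence "?H = transpose ?H"
    using matrix_inv_works(3) by blast
  hence "?H $ i $ j = transpose ?H $ i $ j" by simp
  thus ?thesis by (simp add: transpose_def)
qed

lemma smooth_in_pd:
  assumes "smooth_in c f" "p \<in> fst c"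
  shows "differentiable_in c f p" "differentiable_in c (pd c i f) p"
    "pd c i (pd c j f) p = pd c j (pd c i f) p"
  using smooth_on_pd[OF chart dom_open subset_refl assms(2)] assms(1) by (auto simp: smooth_in_def)

lemma g_smooth: "smooth_in c (\<lambda>q. g c q $ i $ j)"
  using metric c by (simp add: riemannian_metric_def smooth_tensor2_def)

lemma g_diff: "p \<in> fst c \<Longrightarrow> differentiable_in c (\<lambda>q. g c q $ i $ j) p"
  and dg_diff: "p \<in> fst c \<Longrightarrow> differentiable_in c (pd c k (\<lambda>q. g c q $ i $ j)) p"
  using smooth_in_pd[OF g_smooth] by auto

lemma g_inv_diff:
  assumes "p \<in> fst c"
  shows "differentiable_in c (\<lambda>q. matrix_inv (g c q) $ i $ j) p"
proof (rule differentiable_in_matrix_inv[OF chart assms g_diff[OF assms]])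
  fix q assume "q \<in> fst c"
  thus "det (g c q) \<noteq> 0"
    using riemannian_metric_inverse[OF metric c] invertible_det_nz unfolding invertible_def by blast
qed

lemma christoffel_diff:
  assumes "p \<in> fst c"
  shows "differentiable_in c (christoffel g c k i j) p"
  unfolding christoffel_def
  by (intro differentiable_in_mult differentiable_in_sum differentiable_in_add differentiable_in_diff
      differentiable_in_const g_inv_diff dg_diff assms finite)

lemma christoffel_sym: "p \<in> fst c \<Longrightarrow> christoffel g c k i j p = christoffel g c k j i p"
  by (rule christoffel_symmetric[OF manifold metric c])

text \<open>Metric compatibility solved for the derivative of \<open>g\<close>. It replaces metric
  derivatives by connection terms in the formulas for \<open>flat\<close>, for the Lie derivative
  and for the divergence.\<close>

lemma pd_g:
  assumes "p \<in> fst c"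
  shows "pd c k (\<lambda>q. g c q $ i $ j) p = (\<Sum>l\<in>UNIV. christoffel g c l k i p * g c p $ l $ j)
     + (\<Sum>l\<in>UNIV. christoffel g c l k j p * g c p $ i $ l)"
proof -
  have "nabla_tensor g g c p k $ i $ j = 0"
    using levi_civita_metric[OF manifold metric c assms] by simp
  thus ?thesis by (simp add: nabla_tensor_def)
qed

lemma sharp_flat:
  assumes "p \<in> fst c"
  shows "sharp g (flat g X) c p = X c p"
proof -
  have "flat g X c p = g c p *v X c p"
    using g_sym[OF assms] by (simp add: flat_def matrix_vector_mult_def)
  thus ?thesis
    using riemannian_metric_inverse(2)[OF metric c assms]
    by (simp add: sharp_def matrix_vector_mul_assoc)
qed

lemma flat_sharp:
  assumes "p \<in> fst c"
  shows "flat g (sharp g \<gamma>) c p = \<gamma> c p"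
proof -
  have "flat g (sharp g \<gamma>) c p = g c p *v sharp g \<gamma> c p"
    using g_sym[OF assms] by (simp add: flat_def matrix_vector_mult_def)
  thus ?thesis
    using riemannian_metric_inverse(1)[OF metric c assms]
    by (simp add: sharp_def matrix_vector_mul_assoc)
qed

section \<open>Covariant derivative, Lie derivative of the metric and divergence for one smooth
  vector field\<close>

context
  fixes X :: "('a, 'n) vfield"
  assumes X: "smooth_vfield A X"
begin

lemma X_smooth: "smooth_in c (\<lambda>q. X c q $ i)"
  using X c by (simp add: smooth_vfield_def)

lemma X_diff: "p \<in> fst c \<Longrightarrow> differentiable_in c (\<lambda>q. X c q $ i) p"
  and dX_diff: "p \<in> fst c \<Longrightarrow> differentiable_in c (pd c k (\<lambda>q. X c q $ i)) p"
  and ddX: "p \<in> fst c \<Longrightarrow> pd c i (pd c j (\<lambda>q. X c q $ k)) p = pd c j (pd c i (\<lambda>q. X c q $ k)) p"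
  using smooth_in_pd[OF X_smooth] by auto

lemma pd_flat:
  assumes "p \<in> fst c"
  shows "pd c i (\<lambda>q. flat g X c q $ j) p =
    (\<Sum>m\<in>UNIV. g c p $ m $ j * pd c i (\<lambda>q. X c q $ m) p + pd c i (\<lambda>q. g c q $ m $ j) p * X c p $ m)"
  using assms by (simp add: flat_def pd_sum pd_mult[OF chart] differentiable_in_mult g_diff X_diff)

text \<open>Lowering an index commutes with the connection. By \<open>pd_g\<close> the derivative of
  g contributes two Christoffel sums: one completes the derivative of X to its covariant derivative,
  the other cancels the correction term in \<open>nabla_form\<close>.\<close>

lemma nabla_form_flat:
  assumes p: "p \<in> fst c"
  shows "nabla_form g (flat g X) c p $ i $ j = (\<Sum>l\<in>UNIV. nabla_vfield g X c p $ i $ l * g c p $ l $ j)"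
proof -
  let ?\<Gamma> = "\<lambda>k i j. christoffel g c k i j p" and ?X = "X c p" and ?G = "g c p"
  have 1: "(\<Sum>m\<in>UNIV. (\<Sum>l\<in>UNIV. ?\<Gamma> l i m * ?G $ l $ j) * ?X $ m)
      = (\<Sum>l\<in>UNIV. (\<Sum>m\<in>UNIV. ?\<Gamma> l i m * ?X $ m) * ?G $ l $ j)"
    unfolding sum_distrib_right by (subst sum.swap) (simp add: mult_ac)
  have 2: "(\<Sum>m\<in>UNIV. (\<Sum>l\<in>UNIV. ?\<Gamma> l i j * ?G $ m $ l) * ?X $ m)
      = (\<Sum>k\<in>UNIV. ?\<Gamma> k i j * (\<Sum>m\<in>UNIV. ?G $ m $ k * ?X $ m))"
    unfolding sum_distrib_right sum_distrib_left by (subst sum.swap) (simp add: mult_ac)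
  show ?thesis
    using 1 2 unfolding nabla_form_def vec_lambda_beta pd_flat[OF p] pd_g[OF p]
    by (simp add: nabla_vfield_def sum.distrib distrib_right distrib_left flat_def mult.commute)
qed

text \<open>Metric compatibility splits the derivative of g along X into two Christoffel sums, and
  the symmetry of the lower indices turns each of them into the part that a coordinate derivative of
  X lacks to be covariant.\<close>

lemma lie_deriv_metric:
  assumes p: "p \<in> fst c"
  shows "lie_deriv X g c p = nabla_form g (flat g X) c p + transpose (nabla_form g (flat g X) c p)"
proof -
  let ?\<Gamma> = "\<lambda>k i j. christoffel g c k i j p" and ?X = "X c p" and ?G = "g c p"
  have "lie_deriv X g c p $ i $ j = nabla_form g (flat g X) c p $ i $ j + nabla_form g (flat g X) c p $ j $ i"
    for i j
  proof -
    have 1: "(\<Sum>k\<in>UNIV. ?X $ k * (\<Sum>l\<in>UNIV. ?\<Gamma> l k i * ?G $ l $ j))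
        = (\<Sum>l\<in>UNIV. (\<Sum>m\<in>UNIV. ?\<Gamma> l i m * ?X $ m) * ?G $ l $ j)" for i j
      unfolding sum_distrib_right sum_distrib_left
      by (subst sum.swap) (simp add: mult_ac christoffel_sym[OF p, of _ _ i])
    show ?thesis
      using 1[of i j] 1[of j i] p g_sym[OF p, of i]
      by (simp add: lie_deriv_def nabla_form_flat pd_g nabla_vfield_def sum.distrib distrib_right
        distrib_left mult.commute)
  qed
  thus ?thesis by (simp add: vec_eq_iff transpose_def)
qed

lemma nabla_vfield_diff:
  assumes "p \<in> fst c"
  shows "differentiable_in c (\<lambda>q. nabla_vfield g X c q $ i $ j) p"
  unfolding nabla_vfield_def using assms
  by (auto intro!: differentiable_in_add differentiable_in_mult differentiable_in_sum X_diff dX_diff christoffel_diff)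

lemma nabla_form_flat_diff:
  assumes "p \<in> fst c"
  shows "differentiable_in c (\<lambda>q. nabla_form g (flat g X) c q $ i $ j) p"
proof (rule differentiable_in_cong[OF chart dom_open assms subset_refl])
  show "differentiable_in c (\<lambda>q. \<Sum>l\<in>UNIV. nabla_vfield g X c q $ i $ l * g c q $ l $ j) p"
    using assms by (auto intro!: differentiable_in_mult differentiable_in_sum nabla_vfield_diff g_diff)
qed (simp add: nabla_form_flat)

text \<open>In index notation: \<open>\<nabla>\<^sub>i \<nabla>\<^sub>k X\<^sup>i = \<nabla>\<^sub>k \<nabla>\<^sub>i X\<^sup>i + S\<^sub>k\<^sub>m X\<^sup>m\<close>.\<close>

lemma ricci_identity:
  assumes p: "p \<in> fst c"
  defines "N \<equiv> \<lambda>i k q. nabla_vfield g X c q $ i $ k"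
  shows "(\<Sum>i\<in>UNIV. pd c i (N k i) p
      + (\<Sum>l\<in>UNIV. christoffel g c i i l p * N k l p) - (\<Sum>l\<in>UNIV. christoffel g c l i k p * N l i p))
    = (\<Sum>i\<in>UNIV. pd c k (N i i) p) + (\<Sum>m\<in>UNIV. ricci g c p $ k $ m * X c p $ m)"
proof -
  define \<Gamma> where "\<Gamma> k i j = christoffel g c k i j p" for k i j
  define d\<Gamma> where "d\<Gamma> n k i j = pd c n (christoffel g c k i j) p" for n k i j
  define x where "x i = X c p $ i" for i
  define dx where "dx k i = pd c k (\<lambda>q. X c q $ i) p" for k i
  define ddx where "ddx k l i = pd c k (pd c l (\<lambda>q. X c q $ i)) p" for k l i
  have N: "N i k p = dx i k + (\<Sum>m\<in>UNIV. \<Gamma> k i m * x m)" for i k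
    by (simp add: N_def nabla_vfield_def dx_def \<Gamma>_def x_def)
  have dN: "pd c n (N i k) p = ddx n i k + (\<Sum>m\<in>UNIV. \<Gamma> k i m * dx n m) + (\<Sum>m\<in>UNIV. d\<Gamma> n k i m * x m)"
    for n i k
    unfolding N_def nabla_vfield_def using p
    by (simp add: pd_add pd_sum pd_mult[OF chart] differentiable_in_sum differentiable_in_mult
        X_diff dX_diff christoffel_diff sum.distrib \<Gamma>_def d\<Gamma>_def dx_def ddx_def x_def)
  have ddx: "ddx k l i = ddx l k i" for k l i
    using ddX[OF p] by (simp add: ddx_def)
  have sym: "\<Gamma> k i j = \<Gamma> k j i" for k i j
    using christoffel_sym[OF p] by (simp add: \<Gamma>_def)
  have dsym: "d\<Gamma> n k i j = d\<Gamma> n k j i" for n k i j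
    unfolding d\<Gamma>_def by (rule pd_cong[OF chart p christoffel_sym])
  \<comment> \<open>First-order terms in X: those from differentiating the Christoffel part of
    \<open>N k i\<close> cancel against those of the connection correction, after relabelling and by
    torsion-freeness.\<close>
  have 1: "(\<Sum>i\<in>UNIV. \<Sum>l\<in>UNIV. \<Gamma> l i k * dx l i) = (\<Sum>i\<in>UNIV. \<Sum>m\<in>UNIV. \<Gamma> i k m * dx i m)"
    by (subst sum.swap) (simp add: sym[of _ _ k])
  \<comment> \<open>Zeroth-order terms are brought to the form coefficient times \<open>x m\<close>.
    Here the coefficient is the quadratic sum that the Ricci tensor carries with a minus sign, in
    \<open>3\<close> the one with a plus sign, and in \<open>4\<close> its two derivative
    terms.\<close>
  have 2: "(\<Sum>i\<in>UNIV. \<Sum>l\<in>UNIV. \<Gamma> l i k * (\<Sum>m\<in>UNIV. \<Gamma> i l m * x m))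
      = (\<Sum>m\<in>UNIV. (\<Sum>i\<in>UNIV. \<Sum>l\<in>UNIV. \<Gamma> i k l * \<Gamma> l i m) * x m)"
  proof -
    have "(\<Sum>i\<in>UNIV. \<Sum>l\<in>UNIV. \<Gamma> l i k * (\<Sum>m\<in>UNIV. \<Gamma> i l m * x m))
        = (\<Sum>i\<in>UNIV. \<Sum>l\<in>UNIV. \<Sum>m\<in>UNIV. \<Gamma> i k l * \<Gamma> l i m * x m)"
      by (subst sum.swap) (simp add: sum_distrib_left sym[of _ _ k] mult_ac)
    also have "\<dots> = (\<Sum>i\<in>UNIV. \<Sum>m\<in>UNIV. \<Sum>l\<in>UNIV. \<Gamma> i k l * \<Gamma> l i m * x m)"
      by (intro sum.cong refl sum.swap)
    also have "\<dots> = (\<Sum>m\<in>UNIV. \<Sum>i\<in>UNIV. \<Sum>l\<in>UNIV. \<Gamma> i k l * \<Gamma> l i m * x m)"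
      by (rule sum.swap)
    finally show ?thesis by (simp add: sum_distrib_right)
  qed
  have 3: "(\<Sum>i\<in>UNIV. \<Sum>l\<in>UNIV. \<Gamma> i i l * (\<Sum>m\<in>UNIV. \<Gamma> l k m * x m))
      = (\<Sum>m\<in>UNIV. (\<Sum>i\<in>UNIV. \<Sum>l\<in>UNIV. \<Gamma> i i l * \<Gamma> l k m) * x m)"
  proof -
    have "(\<Sum>i\<in>UNIV. \<Sum>l\<in>UNIV. \<Gamma> i i l * (\<Sum>m\<in>UNIV. \<Gamma> l k m * x m))
        = (\<Sum>i\<in>UNIV. \<Sum>l\<in>UNIV. \<Sum>m\<in>UNIV. \<Gamma> i i l * \<Gamma> l k m * x m)"
      by (simp add: sum_distrib_left mult_ac)
    also have "\<dots> = (\<Sum>i\<in>UNIV. \<Sum>m\<in>UNIV. \<Sum>l\<in>UNIV. \<Gamma> i i l * \<Gamma> l k m * x m)"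
      by (intro sum.cong refl sum.swap)
    also have "\<dots> = (\<Sum>m\<in>UNIV. \<Sum>i\<in>UNIV. \<Sum>l\<in>UNIV. \<Gamma> i i l * \<Gamma> l k m * x m)"
      by (rule sum.swap)
    finally show ?thesis by (simp add: sum_distrib_right)
  qed
  have 4: "(\<Sum>i\<in>UNIV. \<Sum>m\<in>UNIV. d\<Gamma> i i k m * x m) = (\<Sum>m\<in>UNIV. (\<Sum>i\<in>UNIV. d\<Gamma> i i k m) * x m)"
    "(\<Sum>i\<in>UNIV. \<Sum>m\<in>UNIV. d\<Gamma> k i i m * x m) = (\<Sum>m\<in>UNIV. (\<Sum>i\<in>UNIV. d\<Gamma> k i i m) * x m)"
    unfolding sum_distrib_right by (rule sum.swap)+
  have ric: "ricci g c p $ k $ m = (\<Sum>i\<in>UNIV. d\<Gamma> i i k m) - (\<Sum>i\<in>UNIV. d\<Gamma> k i i m)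
      + (\<Sum>i\<in>UNIV. \<Sum>l\<in>UNIV. \<Gamma> i i l * \<Gamma> l k m) - (\<Sum>i\<in>UNIV. \<Sum>l\<in>UNIV. \<Gamma> i k l * \<Gamma> l i m)" for m
    by (simp add: ricci_def \<Gamma>_def d\<Gamma>_def sum.distrib sum_subtractf)
  have "(\<Sum>m\<in>UNIV. ricci g c p $ k $ m * x m) =
      (\<Sum>i\<in>UNIV. \<Sum>m\<in>UNIV. d\<Gamma> i i k m * x m) - (\<Sum>i\<in>UNIV. \<Sum>m\<in>UNIV. d\<Gamma> k i i m * x m)
      + (\<Sum>i\<in>UNIV. \<Sum>l\<in>UNIV. \<Gamma> i i l * (\<Sum>m\<in>UNIV. \<Gamma> l k m * x m))
      - (\<Sum>i\<in>UNIV. \<Sum>l\<in>UNIV. \<Gamma> l i k * (\<Sum>m\<in>UNIV. \<Gamma> i l m * x m))"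
    unfolding 2 3 4 ric by (simp add: left_diff_distrib distrib_right sum.distrib sum_subtractf)
  moreover have "(\<Sum>i\<in>UNIV. pd c i (N k i) p + (\<Sum>l\<in>UNIV. \<Gamma> i i l * N k l p) - (\<Sum>l\<in>UNIV. \<Gamma> l i k * N l i p))
    = (\<Sum>i\<in>UNIV. ddx k i i) + (\<Sum>i\<in>UNIV. \<Sum>m\<in>UNIV. \<Gamma> i k m * dx i m) + (\<Sum>i\<in>UNIV. \<Sum>m\<in>UNIV. d\<Gamma> i i k m * x m)
      + (\<Sum>i\<in>UNIV. \<Sum>l\<in>UNIV. \<Gamma> i i l * dx k l) + (\<Sum>i\<in>UNIV. \<Sum>l\<in>UNIV. \<Gamma> i i l * (\<Sum>m\<in>UNIV. \<Gamma> l k m * x m))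
      - (\<Sum>i\<in>UNIV. \<Sum>l\<in>UNIV. \<Gamma> l i k * dx l i)
      - (\<Sum>i\<in>UNIV. \<Sum>l\<in>UNIV. \<Gamma> l i k * (\<Sum>m\<in>UNIV. \<Gamma> i l m * x m))"
    by (simp add: N dN distrib_left sum.distrib sum_subtractf ddx[of _ k])
  moreover have "(\<Sum>i\<in>UNIV. pd c k (N i i) p) = (\<Sum>i\<in>UNIV. ddx k i i) + (\<Sum>i\<in>UNIV. \<Sum>l\<in>UNIV. \<Gamma> i i l * dx k l)
      + (\<Sum>i\<in>UNIV. \<Sum>m\<in>UNIV. d\<Gamma> k i i m * x m)"
    by (simp add: dN sum.distrib)
  ultimately show ?thesis
    using 1 by (simp add: \<Gamma>_def x_def)
qed

text \<open>In the transposed tensor the divergence contracts with the component index of X rather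
  than with the inner derivative direction, so the two covariant derivatives stand in the wrong
  order for div X. Metric compatibility pulls g out, the trace cancels it against its inverse, and
  the exchange by \<open>ricci_identity\<close> produces the curvature term.\<close>

lemma div_tensor_transpose:
  assumes p: "p \<in> fst c"
  shows "div_tensor g (\<lambda>c p. transpose (nabla_form g (flat g X) c p)) c p $ k =
    pd c k (\<lambda>q. \<Sum>i\<in>UNIV. nabla_vfield g X c q $ i $ i) p + (\<Sum>m\<in>UNIV. ricci g c p $ k $ m * X c p $ m)"
proof -
  let ?T = "\<lambda>c p. transpose (nabla_form g (flat g X) c p)"
  define N where "N i k q = nabla_vfield g X c q $ i $ k" for i k q
  define \<Gamma> where "\<Gamma> k i j = christoffel g c k i j p" for k i j
  define G where "G = g c p"
  \<comment> \<open>The second covariant derivative of X: outer direction i, inner direction k,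
    vector component m.\<close>
  define E where "E i m = pd c i (N k m) p + (\<Sum>l\<in>UNIV. \<Gamma> m i l * N k l p) - (\<Sum>l\<in>UNIV. \<Gamma> l i k * N l m p)"
    for i m
  have T: "?T c q $ j $ k = (\<Sum>m\<in>UNIV. N k m q * g c q $ m $ j)" if "q \<in> fst c" for q j k
    using that by (simp add: transpose_def nabla_form_flat N_def)
  have Nd: "differentiable_in c (N i m) p" for i m
    using nabla_vfield_diff[OF p] by (simp add: N_def[abs_def])
  have "nabla_tensor g ?T c p i $ j $ k = (\<Sum>m\<in>UNIV. E i m * G $ m $ j)" for i j
  proof -
    have "pd c i (\<lambda>q. ?T c q $ j $ k) p = pd c i (\<lambda>q. \<Sum>m\<in>UNIV. N k m q * g c q $ m $ j) p"
      by (rule pd_cong[OF chart p T])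
    also have "\<dots> = (\<Sum>m\<in>UNIV. N k m p * (\<Sum>l\<in>UNIV. \<Gamma> l i m * G $ l $ j))
       + (\<Sum>m\<in>UNIV. N k m p * (\<Sum>l\<in>UNIV. \<Gamma> l i j * G $ m $ l)) + (\<Sum>m\<in>UNIV. pd c i (N k m) p * G $ m $ j)"
      using p by (simp add: pd_sum pd_mult[OF chart] differentiable_in_mult Nd g_diff pd_g
          sum.distrib distrib_left \<Gamma>_def G_def)
    finally have 1: "pd c i (\<lambda>q. ?T c q $ j $ k) p = \<dots>" .
    have 2: "(\<Sum>m\<in>UNIV. N k m p * (\<Sum>l\<in>UNIV. \<Gamma> l i m * G $ l $ j))
        = (\<Sum>m\<in>UNIV. (\<Sum>l\<in>UNIV. \<Gamma> m i l * N k l p) * G $ m $ j)"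
      unfolding sum_distrib_left sum_distrib_right by (subst sum.swap) (simp add: mult_ac)
    have 3: "(\<Sum>m\<in>UNIV. N k m p * (\<Sum>l\<in>UNIV. \<Gamma> l i j * G $ m $ l)) = (\<Sum>l\<in>UNIV. \<Gamma> l i j * ?T c p $ l $ k)"
      unfolding T[OF p] sum_distrib_left by (subst sum.swap) (simp add: mult_ac G_def)
    have 4: "(\<Sum>l\<in>UNIV. \<Gamma> l i k * ?T c p $ j $ l) = (\<Sum>m\<in>UNIV. (\<Sum>l\<in>UNIV. \<Gamma> l i k * N l m p) * G $ m $ j)"
      unfolding T[OF p] sum_distrib_left sum_distrib_right by (subst sum.swap) (simp add: mult_ac G_def)
    have "nabla_tensor g ?T c p i $ j $ k = pd c i (\<lambda>q. ?T c q $ j $ k) p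
       - (\<Sum>l\<in>UNIV. \<Gamma> l i j * ?T c p $ l $ k) - (\<Sum>l\<in>UNIV. \<Gamma> l i k * ?T c p $ j $ l)"
      by (simp add: nabla_tensor_def \<Gamma>_def)
    also have "\<dots> = (\<Sum>m\<in>UNIV. E i m * G $ m $ j)"
      unfolding 1 2 3 4 E_def by (simp add: left_diff_distrib distrib_right sum.distrib sum_subtractf)
    finally show ?thesis .
  qed
  hence "div_tensor g ?T c p $ k = (\<Sum>i\<in>UNIV. \<Sum>j\<in>UNIV. matrix_inv G $ i $ j * (\<Sum>m\<in>UNIV. E i m * G $ m $ j))"
    by (simp add: div_tensor_def metric_trace_def G_def)
  also have "\<dots> = (\<Sum>i\<in>UNIV. \<Sum>m\<in>UNIV. E i m * (\<Sum>j\<in>UNIV. G $ m $ j * matrix_inv G $ j $ i))"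
    unfolding sum_distrib_left
    by (rule sum.cong[OF refl], subst sum.swap) (simp add: mult_ac G_def g_inv_sym[OF p])
  also have "\<dots> = (\<Sum>i\<in>UNIV. E i i)"
    by (simp add: G_def g_inv[OF p])
  also have "\<dots> = (\<Sum>i\<in>UNIV. pd c k (N i i) p) + (\<Sum>m\<in>UNIV. ricci g c p $ k $ m * X c p $ m)"
    using ricci_identity[OF p, of k] by (simp add: E_def N_def[abs_def] \<Gamma>_def)
  finally show ?thesis
    using Nd by (simp add: pd_sum N_def[abs_def])
qed

text \<open>Of the two halves of \<open>lie_deriv_metric\<close>, the untransposed one has
  divergence \<open>laplacian\<close> by definition, and the transposed one supplies Ricci curvature
  and d(div X). This is the identity that fixes the convention for the Laplacian.\<close>

lemma div_lie_deriv_metric: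
  assumes p: "p \<in> fst c"
  shows "div_tensor g (lie_deriv X g) c p $ k = laplacian g (flat g X) c p $ k
    + (\<Sum>m\<in>UNIV. ricci g c p $ k $ m * X c p $ m)
    + pd c k (\<lambda>q. \<Sum>i\<in>UNIV. nabla_vfield g X c q $ i $ i) p"
proof -
  let ?B = "nabla_form g (flat g X)"
  have B: "differentiable_in c (\<lambda>q. ?B c q $ i $ j) p" for i j
    using nabla_form_flat_diff[OF p] .
  have "nabla_tensor g (lie_deriv X g) c p i = nabla_tensor g ?B c p i + nabla_tensor g (\<lambda>c p. transpose (?B c p)) c p i"
    for i
  proof -
    have "pd c i (\<lambda>q. lie_deriv X g c q $ j $ k) p = pd c i (\<lambda>q. ?B c q $ j $ k + ?B c q $ k $ j) p" for j k
      by (rule pd_cong[OF chart p]) (simp add: lie_deriv_metric transpose_def)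
    thus ?thesis
      using B p by (simp add: vec_eq_iff nabla_tensor_def lie_deriv_metric transpose_def pd_add
          distrib_left sum.distrib)
  qed
  hence "div_tensor g (lie_deriv X g) c p $ k = div_tensor g ?B c p $ k + div_tensor g (\<lambda>c p. transpose (?B c p)) c p $ k"
    by (simp add: div_tensor_def metric_trace_def distrib_left sum.distrib)
  thus ?thesis
    by (simp add: div_tensor_transpose[OF p] laplacian_def)
qed

lemma metric_trace_lie_deriv:
  assumes p: "p \<in> fst c"
  shows "metric_trace (g c p) (lie_deriv X g c p) = 2 * (\<Sum>i\<in>UNIV. nabla_vfield g X c p $ i $ i)"
proof -
  let ?N = "nabla_vfield g X c p" and ?G = "g c p" and ?H = "matrix_inv (g c p)"
  let ?B = "nabla_form g (flat g X) c p"
  have "metric_trace ?G ?B = (\<Sum>i\<in>UNIV. \<Sum>l\<in>UNIV. ?N $ i $ l * (\<Sum>j\<in>UNIV. ?G $ l $ j * ?H $ j $ i))"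
    unfolding metric_trace_def nabla_form_flat[OF p] sum_distrib_left
    by (rule sum.cong[OF refl], subst sum.swap) (simp add: mult_ac g_inv_sym[OF p])
  hence 1: "metric_trace ?G ?B = (\<Sum>i\<in>UNIV. ?N $ i $ i)"
    by (simp add: g_inv[OF p])
  have 2: "metric_trace ?G (transpose ?B) = metric_trace ?G ?B"
    unfolding metric_trace_def by (subst sum.swap) (simp add: transpose_def g_inv_sym[OF p])
  show ?thesis
    using 1 2 by (simp add: lie_deriv_metric[OF p] metric_trace_add)
qed

end

lemma metric_trace_self:
  assumes "p \<in> fst c"
  shows "metric_trace (g c p) (g c p) = CARD('n)"
proof -
  have "metric_trace (g c p) (g c p) = (\<Sum>i\<in>UNIV. \<Sum>j\<in>UNIV. matrix_inv (g c p) $ i $ j * g c p $ j $ i)"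
    using g_sym[OF assms] by (simp add: metric_trace_def)
  thus ?thesis by (simp add: g_inv[OF assms])
qed

lemma metric_trace_tensor_square:
  assumes "p \<in> fst c"
  shows "metric_trace (g c p) (tensor_square (flat g X) c p) = X c p \<bullet> (g c p *v X c p)"
proof -
  have "metric_trace (g c p) (tensor_square (flat g X) c p)
      = (\<Sum>i\<in>UNIV. flat g X c p $ i * sharp g (flat g X) c p $ i)"
    by (simp add: metric_trace_def tensor_square_def sharp_def matrix_vector_mult_def
        sum_distrib_left mult_ac)
  also have "\<dots> = (\<Sum>i\<in>UNIV. flat g X c p $ i * X c p $ i)"
    by (simp add: sharp_flat[OF assms])
  finally show ?thesis
    using g_sym[OF assms] by (simp add: inner_vec_def matrix_vector_mult_def flat_def mult.commute)
qed

end

section \<open>Change of charts\<close>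

lemma has_derivative_vec_lambda:
  fixes f :: "'b::real_normed_vector \<Rightarrow> real^'n"
  assumes "\<And>i. ((\<lambda>x. f x $ i) has_derivative D i) (at x)"
  shows "(f has_derivative (\<lambda>h. \<chi> i. D i h)) (at x)"
proof -
  have "((\<lambda>x. f x \<bullet> b) has_derivative (\<lambda>h. (\<chi> i. D i h) \<bullet> b)) (at x)" if b: "b \<in> Basis" for b
  proof -
    obtain i where "b = axis i 1"
      using b by (auto simp: Basis_vec_def)
    thus ?thesis
      using assms[of i] by (simp add: inner_axis)
  qed
  thus ?thesis
    by (subst has_derivative_componentwise_within) simp
qed

lemma linear_sum_axis:
  fixes D :: "real^'n \<Rightarrow> real"
  assumes "linear D"
  shows "D v = (\<Sum>i\<in>UNIV. v $ i * D (axis i 1))"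
proof -
  have "D v = D (\<Sum>i\<in>UNIV. (v $ i) *s axis i 1)"
    by (simp only: basis_expansion)
  also have "\<dots> = (\<Sum>i\<in>UNIV. v $ i * D (axis i 1))"
    using assms by (simp add: linear_sum linear_cmul scalar_mult_eq_scaleR)
  finally show ?thesis .
qed

text \<open>Keeping the derivative in matrix form lets the transformation law of the metric be
  differentiated by the product rule for matrices instead of by nested index sums.\<close>

definition pd_matrix :: "('a, 'n::finite) chart \<Rightarrow> 'n \<Rightarrow> ('a \<Rightarrow> real^'n^'n) \<Rightarrow> 'a \<Rightarrow> real^'n^'n" where
  "pd_matrix c k M p = (\<chi> i j. pd c k (\<lambda>q. M q $ i $ j) p)"

lemma pd_matrix_mult:
  assumes "is_chart c" "p \<in> fst c" "\<And>i j. differentiable_in c (\<lambda>q. M q $ i $ j) p"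
    "\<And>i j. differentiable_in c (\<lambda>q. N q $ i $ j) p"
  shows "pd_matrix c k (\<lambda>q. M q ** N q) p = M p ** pd_matrix c k N p + pd_matrix c k M p ** N p"
  using assms by (simp add: vec_eq_iff pd_matrix_def matrix_matrix_mult_def pd_sum pd_mult
      differentiable_in_mult sum.distrib)

lemma pd_matrix_transpose: "pd_matrix c k (\<lambda>q. transpose (M q)) p = transpose (pd_matrix c k M p)"
  by (simp add: vec_eq_iff pd_matrix_def transpose_def)

lemma differentiable_in_matrix_mult:
  assumes "\<And>i j. differentiable_in c (\<lambda>q. M q $ i $ j) p" "\<And>i j. differentiable_in c (\<lambda>q. N q $ i $ j) p"
  shows "differentiable_in c (\<lambda>q. (M q ** N q) $ i $ j) p"
  using assms by (auto simp: matrix_matrix_mult_def intro!: differentiable_in_sum differentiable_in_mult)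

lemma matrix_add_rdistrib: "(L + M) ** N = L ** N + M ** (N :: real^'n^'n)"
  by (simp add: vec_eq_iff matrix_matrix_mult_def distrib_right sum.distrib)

lemma trace_transpose: "trace (transpose M) = trace M"
  by (simp add: trace_def transpose_def)

text \<open>The left-hand side is \<open>tr (M\<^sup>-\<^sup>1 dM)\<close>, the logarithmic derivative of \<open>det M\<close>, for
  \<open>M = J\<^sup>T G J\<close>.\<close>

lemma trace_congruence_deriv:
  fixes J K G H dJ dG :: "real^'n^'n"
  assumes JK: "J ** K = mat 1" and GH: "G ** H = mat 1"
  shows "trace ((K ** H ** transpose K) **
      (transpose dJ ** G ** J + transpose J ** dG ** J + transpose J ** G ** dJ))
    = 2 * trace (K ** dJ) + trace (H ** dG)"
proof -
  have KJt: "transpose K ** transpose J = mat 1"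
    using arg_cong[OF JK, of transpose] by (simp add: matrix_transpose_mul)
  have HG: "H ** G = mat 1"
    using GH matrix_left_right_inverse by blast
  have cancel: "P ** (Q ** Z) = Z" if "P ** Q = mat 1" for P Q Z :: "real^'n^'n"
    by (subst matrix_mul_assoc) (simp only: that matrix_mul_lid)
  note c1 = cancel[OF KJt] cancel[OF HG] cancel[OF GH] cancel[OF JK]
  have "trace ((K ** H ** transpose K) ** (transpose J ** G ** dJ)) = trace (K ** dJ)"
    by (simp only: c1 matrix_mul_assoc[symmetric])
  moreover have "trace ((K ** H ** transpose K) ** (transpose J ** dG ** J)) = trace (H ** dG)"
    using trace_mul_sym[of "K ** (H ** dG)" J] by (simp only: c1 matrix_mul_assoc[symmetric])
  \<comment> \<open>Cyclic rotation brings G J K H together, which cancels; what remains is the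
    transpose of dJ K. So this term repeats the first one, whence the factor 2.\<close>
  moreover have "trace ((K ** H ** transpose K) ** (transpose dJ ** G ** J)) = trace (K ** dJ)"
  proof -
    have "trace ((K ** H ** transpose K) ** (transpose dJ ** G ** J)) = trace (transpose K ** transpose dJ)"
      using trace_mul_sym[of "K ** (H ** (transpose K ** transpose dJ))" "G ** J"]
      by (simp only: c1 matrix_mul_assoc[symmetric])
    also have "\<dots> = trace (dJ ** K)"
      using trace_transpose[of "dJ ** K"] by (simp only: matrix_transpose_mul)
    finally show ?thesis by (simp only: trace_mul_sym[of dJ K])
  qed
  ultimately show ?thesis
    by (simp add: matrix_add_ldistrib trace_add)
qed

section \<open>Two overlapping charts: Jacobian, chain rule, symmetric second derivatives\<close>

locale chart_pair =
  fixes A :: "('a::{t2_space, second_countable_topology}, 'n::finite) chart set"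
    and c c' :: "('a, 'n) chart" and p :: 'a
  assumes manifold: "smooth_manifold A" and c: "c \<in> A" "c' \<in> A" and p: "p \<in> fst c" "p \<in> fst c'"
begin

lemma charts: "is_chart c" "is_chart c'"
  using manifold c by (auto simp: smooth_manifold_def)

abbreviation "W \<equiv> fst c \<inter> fst c'"

lemma overlap: "open W" "W \<subseteq> fst c" "p \<in> W"
  using charts p by (auto simp: is_chart_def)

text \<open>\<open>pd_jac\<close> is the commutation of second derivatives of the transition map; it
  is what makes the divergence transform correctly.\<close>

lemma transition:
  shows transition_diff: "differentiable_in c (\<lambda>q. snd c' q $ i) p"
    and jac_diff: "differentiable_in c (\<lambda>q. jac c c' q $ i $ j) p"
    and pd_jac: "pd c k (\<lambda>q. jac c c' q $ i $ j) p = pd c j (\<lambda>q. jac c c' q $ i $ k) p"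
proof -
  have "smooth_on (snd c ` W) ((\<lambda>q. snd c' q $ i) \<circ> chart_inv c)"
    using manifold c by (simp add: smooth_manifold_def o_def)
  from smooth_on_pd[OF charts(1) overlap this]
  show "differentiable_in c (\<lambda>q. snd c' q $ i) p" "differentiable_in c (\<lambda>q. jac c c' q $ i $ j) p"
    "pd c k (\<lambda>q. jac c c' q $ i $ j) p = pd c j (\<lambda>q. jac c c' q $ i $ k) p"
    by (simp_all add: jac_def)
qed

lemma chain_rule:
  assumes f: "differentiable_in c' f p"
  shows "differentiable_in c f p" "pd c k f p = (\<Sum>a\<in>UNIV. pd c' a f p * jac c c' p $ a $ k)"
proof -
  let ?\<phi> = "\<lambda>x. snd c' (chart_inv c x)"
  obtain D where D: "(f \<circ> chart_inv c' has_derivative D) (at (snd c' p))"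
    using f by (auto simp: differentiable_in_def differentiable_def)
  have D': "(f \<circ> chart_inv c' has_derivative D) (at (?\<phi> (snd c p)))"
    using D by (simp add: chart_inv_left[OF charts(1) p(1)])
  have "\<exists>E. ((\<lambda>x. ?\<phi> x $ i) has_derivative E) (at (snd c p))" for i
    using transition_diff[of i] by (simp add: differentiable_in_def differentiable_def o_def)
  then obtain E where E: "\<And>i. ((\<lambda>x. ?\<phi> x $ i) has_derivative E i) (at (snd c p))"
    by metis
  have jac: "jac c c' p $ a $ k = E a (axis k 1)" for a
    using partial_eq[OF E, of k a] by (simp add: jac_def pd_def o_def)
  have comp: "((\<lambda>x. (f \<circ> chart_inv c') (?\<phi> x)) has_derivative (\<lambda>h. D (\<chi> i. E i h))) (at (snd c p))"
    using has_derivative_compose[OF has_derivative_vec_lambda[of ?\<phi>, OF E], of "f \<circ> chart_inv c'" D] D' by simp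
  have *: "(f \<circ> chart_inv c has_derivative (\<lambda>h. D (\<chi> i. E i h))) (at (snd c p))"
  proof (rule has_derivative_transform_within_open[OF comp chart_image_open[OF charts(1) overlap(1,2)]])
    fix y assume "y \<in> snd c ` W"
    thus "(f \<circ> chart_inv c') (?\<phi> y) = (f \<circ> chart_inv c) y"
      by (auto simp: chart_inv_left[OF charts(1)] chart_inv_left[OF charts(2)])
  qed (use overlap in auto)
  show "differentiable_in c f p"
    using * by (auto simp: differentiable_in_def differentiable_def)
  have "pd c k f p = D (\<chi> i. E i (axis k 1))"
    using partial_eq[OF *] by (simp add: pd_def)
  also have "\<dots> = (\<Sum>a\<in>UNIV. E a (axis k 1) * D (axis a 1))"
    by (subst linear_sum_axis[OF has_derivative_linear[OF D]]) simp
  finally show "pd c k f p = (\<Sum>a\<in>UNIV. pd c' a f p * jac c c' p $ a $ k)"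
    using partial_eq[OF D] by (simp add: jac pd_def mult.commute)
qed

text \<open>The assumptions are symmetric in the two charts, so every fact is also available with
  the roles of \<open>c\<close> and \<open>c'\<close> exchanged.\<close>

sublocale swap: chart_pair A c' c p
  using manifold c p by unfold_locales

lemma pd_coordinate: "pd c k (\<lambda>q. snd c q $ i) p = (if i = k then 1 else 0)"
proof -
  have "pd c k (\<lambda>q. snd c q $ i) p = partial k (\<lambda>x. x $ i) (snd c p)"
    unfolding pd_def
    by (rule partial_cong[of "snd c ` fst c"])
      (use charts(1) p(1) chart_inv_right(1)[OF charts(1)] in \<open>auto simp: is_chart_def\<close>)
  also have "\<dots> = axis k 1 $ i"
    by (rule partial_eq) (rule bounded_linear_imp_has_derivative[OF bounded_linear_vec_nth])
  finally show ?thesis by (auto simp: axis_def)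
qed

text \<open>The chain rule applied to the coordinate functions of \<open>c\<close> itself,
  differentiated through \<open>c'\<close>.\<close>

lemma jac_inverse: "jac c' c p ** jac c c' p = mat 1"
proof -
  have "(\<Sum>a\<in>UNIV. jac c' c p $ i $ a * jac c c' p $ a $ k) = (if i = k then 1 else 0)" for i k
    using chain_rule(2)[OF swap.transition_diff, of k i] pd_coordinate[of k i] by (simp add: jac_def)
  thus ?thesis
    by (simp add: vec_eq_iff matrix_matrix_mult_def mat_def)
qed

end

text \<open>The expression behind \<open>div_vfield\<close> with the chart held fixed, so that it
  can be differentiated in that chart.\<close>

definition chart_div :: "('a, 'n::finite) tensor2 \<Rightarrow> ('a, 'n) vfield \<Rightarrow> ('a, 'n) chart \<Rightarrow> 'a \<Rightarrow> real" where
  "chart_div g X c p = (\<Sum>i\<in>UNIV. nabla_vfield g X c p $ i $ i)"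

text \<open>In the contracted Christoffel symbol two of the three metric derivatives cancel by
  symmetry of the inverse metric. The remaining trace is the logarithmic derivative of det g, so
  this is the classical formula with the density sqrt(det g), written without differentiating a
  determinant.\<close>

lemma (in riemannian_chart) chart_div_eq:
  assumes p: "p \<in> fst c"
  shows "chart_div g X c p = (\<Sum>i\<in>UNIV. pd c i (\<lambda>q. X c q $ i) p)
    + (1/2) * (\<Sum>j\<in>UNIV. X c p $ j * trace (matrix_inv (g c p) ** pd_matrix c j (g c) p))"
proof -
  define H where "H i j = matrix_inv (g c p) $ i $ j" for i j
  define d where "d k i j = pd c k (\<lambda>q. g c q $ i $ j) p" for k i j
  have dsym: "d k i j = d k j i" for k i j
    unfolding d_def by (rule pd_cong[OF chart p g_sym])
  have "(\<Sum>i\<in>UNIV. christoffel g c i i j p) = (1/2) * trace (matrix_inv (g c p) ** pd_matrix c j (g c) p)" for j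
  proof -
    have 1: "(\<Sum>i\<in>UNIV. \<Sum>l\<in>UNIV. H i l * d i j l) = (\<Sum>i\<in>UNIV. \<Sum>l\<in>UNIV. H i l * d l i j)"
      by (subst sum.swap) (simp add: H_def g_inv_sym[OF p] dsym[of _ j])
    have "(\<Sum>i\<in>UNIV. christoffel g c i i j p)
        = (1/2) * (\<Sum>i\<in>UNIV. \<Sum>l\<in>UNIV. H i l * (d i j l + d j i l - d l i j))"
      by (simp add: christoffel_def H_def d_def sum_distrib_left)
    also have "\<dots> = (1/2) * (\<Sum>i\<in>UNIV. \<Sum>l\<in>UNIV. H i l * d j l i)"
      using 1 by (simp add: distrib_left right_diff_distrib sum.distrib sum_subtractf dsym[of j])
    finally show ?thesis
      by (simp add: trace_def matrix_matrix_mult_def pd_matrix_def H_def d_def)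
  qed
  note \<Gamma> = this
  have "(\<Sum>i\<in>UNIV. \<Sum>j\<in>UNIV. christoffel g c i i j p * X c p $ j)
      = (\<Sum>j\<in>UNIV. (\<Sum>i\<in>UNIV. christoffel g c i i j p) * X c p $ j)"
    by (subst sum.swap) (simp add: sum_distrib_right)
  thus ?thesis
    by (simp add: chart_div_def nabla_vfield_def sum.distrib \<Gamma> sum_distrib_left mult_ac)
qed

text \<open>Two corrections agree, both equal to the sum of X^k tr(K dJ_k): one arises on the side
  of \<open>c\<close> from half the trace of the differentiated metric law, the other on the side of
  \<open>c'\<close> from differentiating X' = J X.\<close>

lemma (in chart_pair) chart_div_invariant:
  assumes g: "riemannian_metric A g" and X: "smooth_vfield A X"
  shows "chart_div g X c p = chart_div g X c' p"
proof -
  interpret G: riemannian_chart A g c using manifold g c by unfold_locales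
  interpret G': riemannian_chart A g c' using manifold g c by unfold_locales
  define J where "J = jac c c'"
  define K where "K = jac c' c p"
  define dJ where "dJ k = pd_matrix c k J p" for k
  define H where "H = matrix_inv (g c' p)"
  have KJ: "K ** J p = mat 1" and JK: "J p ** K = mat 1"
    using jac_inverse swap.jac_inverse by (simp_all add: J_def K_def)
  have Jd: "differentiable_in c (\<lambda>q. J q $ i $ j) p" for i j
    using jac_diff by (simp add: J_def)
  have Xt: "X c' q = J q *v X c q" if "q \<in> W" for q
    using conjunct2[OF X[unfolded smooth_vfield_def]] c that unfolding J_def by blast
  have gt: "g c q = transpose (J q) ** g c' q ** J q" if "q \<in> W" for q
    using conjunct2[OF conjunct1[OF g[unfolded riemannian_metric_def smooth_tensor2_def]]] c that
    unfolding J_def by blast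
  have g'd: "differentiable_in c (\<lambda>q. g c' q $ i $ j) p" for i j
    using chain_rule(1)[OF G'.g_diff[OF p(2)]] .
  have dg: "pd_matrix c k (g c) p = transpose (dJ k) ** g c' p ** J p
      + transpose (J p) ** pd_matrix c k (g c') p ** J p + transpose (J p) ** g c' p ** dJ k" for k
  proof -
    have tJd: "differentiable_in c (\<lambda>q. transpose (J q) $ i $ j) p" for i j
      using Jd by (simp add: transpose_def)
    have "pd_matrix c k (g c) p = pd_matrix c k (\<lambda>q. (transpose (J q) ** g c' q) ** J q) p"
      unfolding pd_matrix_def vec_eq_iff vec_lambda_beta
      by (intro allI pd_cong_open[OF charts(1) overlap(1,3,2)]) (simp add: gt)
    also have "\<dots> = transpose (J p) ** g c' p ** dJ k
        + (transpose (J p) ** pd_matrix c k (g c') p + transpose (dJ k) ** g c' p) ** J p"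
      using charts p tJd g'd Jd
      by (simp add: pd_matrix_mult differentiable_in_matrix_mult pd_matrix_transpose dJ_def)
    finally show ?thesis
      by (simp add: matrix_add_rdistrib)
  qed
  have inv': "g c' p ** H = mat 1"
    using riemannian_metric_inverse(1)[OF g c(2) p(2)] by (simp add: H_def)
  have "g c p ** (K ** H ** transpose K) = mat 1"
  proof -
    have "g c p ** (K ** H ** transpose K)
        = transpose (J p) ** (g c' p ** ((J p ** K) ** (H ** transpose K)))"
      using overlap by (simp only: gt[OF overlap(3)] matrix_mul_assoc[symmetric])
    also have "\<dots> = transpose (J p) ** ((g c' p ** H) ** transpose K)"
      by (simp only: JK matrix_mul_lid) (simp only: matrix_mul_assoc)
    also have "\<dots> = transpose (K ** J p)"
      by (simp add: inv' matrix_transpose_mul)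
    finally show ?thesis by (simp add: KJ)
  qed
  hence inv: "matrix_inv (g c p) = K ** H ** transpose K"
    using matrix_inv_works(3) matrix_left_right_inverse by blast
  have tr: "trace (matrix_inv (g c p) ** pd_matrix c k (g c) p)
      = 2 * trace (K ** dJ k) + trace (H ** pd_matrix c k (g c') p)" for k
    unfolding inv dg by (rule trace_congruence_deriv[OF JK inv'])
  \<comment> \<open>The directional derivative along X is the same operator in both charts: chain
    rule for the derivatives, Jacobian for the components.\<close>
  have trX: "(\<Sum>k\<in>UNIV. X c p $ k * trace (H ** pd_matrix c k (g c') p))
      = (\<Sum>a\<in>UNIV. X c' p $ a * trace (H ** pd_matrix c' a (g c') p))"
  proof -
    have trH: "trace (H ** pd_matrix c k (g c') p)
        = (\<Sum>a\<in>UNIV. trace (H ** pd_matrix c' a (g c') p) * J p $ a $ k)" for k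
    proof -
      have "trace (H ** pd_matrix c k (g c') p) = (\<Sum>i\<in>UNIV. \<Sum>j\<in>UNIV. \<Sum>a\<in>UNIV.
          H $ i $ j * pd c' a (\<lambda>q. g c' q $ j $ i) p * J p $ a $ k)"
        by (simp add: trace_def matrix_matrix_mult_def pd_matrix_def chain_rule(2)[OF G'.g_diff[OF p(2)]]
            J_def sum_distrib_left mult_ac)
      also have "\<dots> = (\<Sum>i\<in>UNIV. \<Sum>a\<in>UNIV. \<Sum>j\<in>UNIV.
          H $ i $ j * pd c' a (\<lambda>q. g c' q $ j $ i) p * J p $ a $ k)"
        by (intro sum.cong refl sum.swap)
      also have "\<dots> = (\<Sum>a\<in>UNIV. \<Sum>i\<in>UNIV. \<Sum>j\<in>UNIV.
          H $ i $ j * pd c' a (\<lambda>q. g c' q $ j $ i) p * J p $ a $ k)"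
        by (rule sum.swap)
      finally show ?thesis
        by (simp add: trace_def matrix_matrix_mult_def pd_matrix_def sum_distrib_right)
    qed
    have X'p: "X c' p $ a = (\<Sum>k\<in>UNIV. J p $ a $ k * X c p $ k)" for a
      using Xt[OF overlap(3)] by (simp add: matrix_vector_mult_def)
    show ?thesis
      unfolding trH X'p sum_distrib_left sum_distrib_right by (subst sum.swap) (simp add: mult_ac)
  qed
  have divX: "(\<Sum>a\<in>UNIV. pd c' a (\<lambda>q. X c' q $ a) p)
      = (\<Sum>i\<in>UNIV. pd c i (\<lambda>q. X c q $ i) p) + (\<Sum>k\<in>UNIV. X c p $ k * trace (K ** dJ k))"
  proof -
    have XJd: "differentiable_in c (\<lambda>q. \<Sum>i\<in>UNIV. J q $ a $ i * X c q $ i) p" for a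
      using Jd G.X_diff[OF X p(1)] by (auto intro!: differentiable_in_sum differentiable_in_mult)
    have Xc': "X c' q $ a = (\<Sum>i\<in>UNIV. J q $ a $ i * X c q $ i)" if "q \<in> W" for q a
      using Xt[OF that] by (simp add: matrix_vector_mult_def)
    have X'd: "differentiable_in c (\<lambda>q. X c' q $ a) p" for a
      by (rule differentiable_in_cong[OF charts(1) overlap(1,3,2) Xc'[symmetric] XJd])
    \<comment> \<open>Commuting second derivatives of the transition map makes the index summed
      against X the direction of differentiation of J, so that contraction with K yields tr(K
      dJ_i).\<close>
    have "pd c m (\<lambda>q. X c' q $ a) p
        = (\<Sum>i\<in>UNIV. J p $ a $ i * pd c m (\<lambda>q. X c q $ i) p) + (\<Sum>i\<in>UNIV. dJ i $ a $ m * X c p $ i)" for m a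
    proof -
      have "pd c m (\<lambda>q. X c' q $ a) p = pd c m (\<lambda>q. \<Sum>i\<in>UNIV. J q $ a $ i * X c q $ i) p"
        by (rule pd_cong_open[OF charts(1) overlap(1,3,2) Xc'])
      also have "\<dots> = (\<Sum>i\<in>UNIV. J p $ a $ i * pd c m (\<lambda>q. X c q $ i) p)
          + (\<Sum>i\<in>UNIV. pd c m (\<lambda>q. J q $ a $ i) p * X c p $ i)"
        using charts p Jd G.X_diff[OF X p(1)]
        by (simp add: pd_sum pd_mult differentiable_in_mult sum.distrib)
      finally show ?thesis
        using pd_jac[of m a] by (simp add: dJ_def pd_matrix_def J_def)
    qed
    note dX' = this
    have "(\<Sum>a\<in>UNIV. pd c' a (\<lambda>q. X c' q $ a) p)
        = (\<Sum>a\<in>UNIV. \<Sum>m\<in>UNIV. pd c m (\<lambda>q. X c' q $ a) p * K $ m $ a)"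
      by (simp add: swap.chain_rule(2)[OF X'd] K_def)
    also have "\<dots> = (\<Sum>a\<in>UNIV. \<Sum>m\<in>UNIV. \<Sum>i\<in>UNIV. K $ m $ a * J p $ a $ i * pd c m (\<lambda>q. X c q $ i) p)
        + (\<Sum>a\<in>UNIV. \<Sum>m\<in>UNIV. \<Sum>i\<in>UNIV. K $ m $ a * dJ i $ a $ m * X c p $ i)"
      by (simp add: dX' distrib_left sum.distrib sum_distrib_left mult_ac)
    also have "(\<Sum>a\<in>UNIV. \<Sum>m\<in>UNIV. \<Sum>i\<in>UNIV. K $ m $ a * J p $ a $ i * pd c m (\<lambda>q. X c q $ i) p)
        = (\<Sum>m\<in>UNIV. \<Sum>i\<in>UNIV. (K ** J p) $ m $ i * pd c m (\<lambda>q. X c q $ i) p)"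
    proof -
      have "(\<Sum>a\<in>UNIV. \<Sum>m\<in>UNIV. \<Sum>i\<in>UNIV. K $ m $ a * J p $ a $ i * pd c m (\<lambda>q. X c q $ i) p)
        = (\<Sum>m\<in>UNIV. \<Sum>a\<in>UNIV. \<Sum>i\<in>UNIV. K $ m $ a * J p $ a $ i * pd c m (\<lambda>q. X c q $ i) p)"
        by (rule sum.swap)
      also have "\<dots> = (\<Sum>m\<in>UNIV. \<Sum>i\<in>UNIV. \<Sum>a\<in>UNIV. K $ m $ a * J p $ a $ i * pd c m (\<lambda>q. X c q $ i) p)"
        by (intro sum.cong refl sum.swap)
      finally show ?thesis
        by (simp add: matrix_matrix_mult_def sum_distrib_right)
    qed
    also have "\<dots> = (\<Sum>i\<in>UNIV. pd c i (\<lambda>q. X c q $ i) p)"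
      by (simp add: KJ mat_def if_distrib[of "\<lambda>x. x * _"] cong: if_cong)
    also have "(\<Sum>a\<in>UNIV. \<Sum>m\<in>UNIV. \<Sum>i\<in>UNIV. K $ m $ a * dJ i $ a $ m * X c p $ i)
        = (\<Sum>k\<in>UNIV. X c p $ k * trace (K ** dJ k))"
    proof -
      have "(\<Sum>a\<in>UNIV. \<Sum>m\<in>UNIV. \<Sum>i\<in>UNIV. K $ m $ a * dJ i $ a $ m * X c p $ i)
        = (\<Sum>m\<in>UNIV. \<Sum>a\<in>UNIV. \<Sum>i\<in>UNIV. K $ m $ a * dJ i $ a $ m * X c p $ i)"
        by (rule sum.swap)
      also have "\<dots> = (\<Sum>m\<in>UNIV. \<Sum>i\<in>UNIV. \<Sum>a\<in>UNIV. K $ m $ a * dJ i $ a $ m * X c p $ i)"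
        by (intro sum.cong refl sum.swap)
      also have "\<dots> = (\<Sum>i\<in>UNIV. \<Sum>m\<in>UNIV. \<Sum>a\<in>UNIV. K $ m $ a * dJ i $ a $ m * X c p $ i)"
        by (rule sum.swap)
      finally show ?thesis
        by (simp add: trace_def matrix_matrix_mult_def sum_distrib_left mult_ac)
    qed
    finally show ?thesis .
  qed
  show ?thesis
    unfolding G.chart_div_eq[OF p(1)] G'.chart_div_eq[OF p(2)] tr divX
    using trX by (simp add: H_def distrib_left sum.distrib sum_distrib_left mult_ac)
qed

section \<open>Functions with vanishing differential\<close>

text \<open>Around each point a ball in coordinates is taken, since its convexity lets a vanishing
  derivative force constancy; the chart image itself may be disconnected. Connectedness of the
  carrier passes from locally constant to constant.\<close>

lemma constant_on_if_pd_zero: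
  fixes A :: "('a::topological_space, 'n::finite) chart set"
  assumes ch: "\<And>c. c \<in> A \<Longrightarrow> is_chart c" and conn: "connected (carrier_of A)"
    and f: "\<And>c p. c \<in> A \<Longrightarrow> p \<in> fst c \<Longrightarrow> differentiable_in c f p"
    and 0: "\<And>c p i. c \<in> A \<Longrightarrow> p \<in> fst c \<Longrightarrow> pd c i f p = 0"
  shows "f constant_on carrier_of A"
proof (rule locally_constant_imp_constant[OF conn])
  fix a assume "a \<in> carrier_of A"
  then obtain c where c: "c \<in> A" "a \<in> fst c"
    by (auto simp: carrier_of_def)
  note chart = ch[OF c(1)]
  have o: "open (fst c)" "open (snd c ` fst c)" and cont: "continuous_on (fst c) (snd c)"
    using chart by (auto simp: is_chart_def homeomorphism_def)
  obtain r where r: "0 < r" "ball (snd c a) r \<subseteq> snd c ` fst c"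
    using o(2) c(2) openE by blast
  define T where "T = fst c \<inter> snd c -` ball (snd c a) r"
  have "open T"
    unfolding T_def using continuous_open_preimage[OF cont o(1)] by simp
  moreover have "T \<subseteq> carrier_of A"
    using c by (auto simp: T_def carrier_of_def)
  ultimately have "openin (top_of_set (carrier_of A)) T"
    by (simp add: open_subset)
  moreover have "a \<in> T"
    using c r by (simp add: T_def)
  moreover have "f q = f a" if "q \<in> T" for q
  proof -
    have "(f \<circ> chart_inv c has_derivative (\<lambda>h. 0)) (at x within ball (snd c a) r)"
      if x: "x \<in> ball (snd c a) r" for x
    proof -
      obtain p where p: "p \<in> fst c" "x = snd c p"
        using x r by auto
      obtain D where D: "(f \<circ> chart_inv c has_derivative D) (at x)"
        using f[OF c(1) p(1)] by (auto simp: differentiable_in_def differentiable_def p(2))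
      have "D (axis i 1) = 0" for i
        using 0[OF c(1) p(1), of i] partial_eq[OF D, of i] by (simp add: pd_def p(2))
      hence "D = (\<lambda>h. 0)"
        by (subst fun_eq_iff, subst linear_sum_axis[OF has_derivative_linear[OF D]]) simp
      thus ?thesis
        using D has_derivative_at_withinI by blast
    qed
    hence "(f \<circ> chart_inv c) (snd c q) = (f \<circ> chart_inv c) (snd c a)"
      by (rule has_derivative_zero_unique[OF convex_ball])
        (use \<open>q \<in> T\<close> \<open>a \<in> T\<close> in \<open>simp_all add: T_def\<close>)
    thus ?thesis
      using \<open>q \<in> T\<close> c(2) by (simp add: T_def chart_inv_left[OF chart])
  qed
  ultimately show "\<exists>T. openin (top_of_set (carrier_of A)) T \<and> a \<in> T \<and> (\<forall>x\<in>T. f x = f a)"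
    by blast
qed

section \<open>Eta-Ricci solitons\<close>

locale eta_soliton =
  fixes A :: "('a::{t2_space, second_countable_topology}, 'n::finite) chart set"
    and g :: "('a, 'n) tensor2" and \<xi> :: "('a, 'n) vfield" and l \<mu> :: real
  assumes manifold: "smooth_manifold A" and connected: "connected (carrier_of A)"
    and soliton: "eta_ricci_soliton A g \<xi> l \<mu>"
begin

definition potential :: "'a \<Rightarrow> real" where
  "potential p = scal A g p + \<mu> * norm_sq A g \<xi> p"

lemma metric: "riemannian_metric A g" and field: "smooth_vfield A \<xi>"
  using soliton by (auto simp: eta_ricci_soliton_def)

lemma charts: "c \<in> A \<Longrightarrow> is_chart c"
  using manifold by (simp add: smooth_manifold_def)

lemma riemannian_chart: "c \<in> A \<Longrightarrow> riemannian_chart A g c"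
  using manifold metric by unfold_locales

lemma soliton_eq:
  assumes "c \<in> A" "p \<in> fst c"
  shows "lie_deriv \<xi> g c p + 2 *\<^sub>R ricci g c p + (2 * l) *\<^sub>R g c p
     + (2 * \<mu>) *\<^sub>R tensor_square (flat g \<xi>) c p = 0"
  using soliton assms by (simp add: eta_ricci_soliton_def field_eq_def)

text \<open>The soliton equation exhibits the Ricci tensor as a combination of symmetric tensors.\<close>

lemma ricci_sym:
  assumes "c \<in> A" "p \<in> fst c"
  shows "ricci g c p $ i $ j = ricci g c p $ j $ i"
proof -
  interpret riemannian_chart A g c using assms(1) by (rule riemannian_chart)
  have eq: "lie_deriv \<xi> g c p $ i $ j + 2 * ricci g c p $ i $ j + 2 * l * g c p $ i $ j
     + 2 * \<mu> * tensor_square (flat g \<xi>) c p $ i $ j = 0" for i j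
    using arg_cong[OF soliton_eq[OF assms], of "\<lambda>M. M $ i $ j"] by simp
  have "lie_deriv \<xi> g c p $ i $ j = lie_deriv \<xi> g c p $ j $ i"
    by (simp add: lie_deriv_metric[OF field assms(2)] transpose_def)
  moreover have "tensor_square (flat g \<xi>) c p $ i $ j = tensor_square (flat g \<xi>) c p $ j $ i"
    by (simp add: tensor_square_def mult.commute)
  ultimately show ?thesis
    using eq[of i j] eq[of j i] g_sym[OF assms(2), of i j] by simp
qed

section \<open>The traced soliton equation and the differential of the potential\<close>

lemma chart_at:
  assumes "p \<in> carrier_of A"
  shows "chart_at A p \<in> A" "p \<in> fst (chart_at A p)"
  using assms someI_ex[of "\<lambda>c. c \<in> A \<and> p \<in> fst c"] unfolding chart_at_def carrier_of_def by blast+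

lemma in_carrier: "c \<in> A \<Longrightarrow> p \<in> fst c \<Longrightarrow> p \<in> carrier_of A"
  by (auto simp: carrier_of_def)

lemma chart_div_chart_at:
  assumes "c \<in> A" "p \<in> fst c"
  shows "chart_div g \<xi> (chart_at A p) p = chart_div g \<xi> c p"
proof -
  interpret chart_pair A "chart_at A p" c p
    using manifold assms chart_at[OF in_carrier[OF assms]] by unfold_locales
  show ?thesis
    by (rule chart_div_invariant[OF metric field])
qed

text \<open>The trace is evaluated in the chart that \<open>scal\<close> and \<open>norm_sq\<close>
  select at \<open>p\<close>, and the divergence alone is then transported to \<open>c\<close>. The
  outcome is a single formula on the whole domain of \<open>c\<close>, which can be differentiated
  there. The term with CARD('n) is the trace of g.\<close>

lemma potential_eq:
  assumes "c \<in> A" "p \<in> fst c"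
  shows "potential p = - chart_div g \<xi> c p - l * CARD('n)"
proof -
  define c0 where "c0 = chart_at A p"
  have c0: "c0 \<in> A" "p \<in> fst c0"
    using chart_at[OF in_carrier[OF assms]] by (simp_all add: c0_def)
  interpret riemannian_chart A g c0 using c0(1) by (rule riemannian_chart)
  have "metric_trace (g c0 p) (lie_deriv \<xi> g c0 p + 2 *\<^sub>R ricci g c0 p + (2 * l) *\<^sub>R g c0 p
     + (2 * \<mu>) *\<^sub>R tensor_square (flat g \<xi>) c0 p) = 0"
    unfolding soliton_eq[OF c0] by (simp add: metric_trace_def)
  moreover have "potential p = metric_trace (g c0 p) (ricci g c0 p) + \<mu> * (\<xi> c0 p \<bullet> (g c0 p *v \<xi> c0 p))"
    by (simp add: potential_def scal_def norm_sq_def Let_def flip: c0_def)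
  ultimately have "2 * chart_div g \<xi> c0 p + 2 * potential p + 2 * l * CARD('n) = 0"
    by (simp add: metric_trace_add metric_trace_scaleR metric_trace_lie_deriv[OF field c0(2)]
        metric_trace_self[OF c0(2)] metric_trace_tensor_square[OF c0(2)] chart_div_def distrib_left)
  thus ?thesis
    using chart_div_chart_at[OF assms] by (simp add: c0_def)
qed

lemma chart_div_diff:
  assumes "c \<in> A" "p \<in> fst c"
  shows "differentiable_in c (chart_div g \<xi> c) p"
proof -
  interpret riemannian_chart A g c using assms(1) by (rule riemannian_chart)
  show ?thesis
    unfolding chart_div_def
    using nabla_vfield_diff[OF field assms(2)] by (intro differentiable_in_sum) auto
qed

lemma potential_diff:
  assumes "c \<in> A" "p \<in> fst c"
  shows "differentiable_in c potential p"
proof (rule differentiable_in_cong)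
  show "differentiable_in c (\<lambda>q. - (l * CARD('n)) - chart_div g \<xi> c q) p"
    by (intro differentiable_in_diff differentiable_in_const chart_div_diff assms)
qed (use assms charts[OF assms(1)] in \<open>auto simp: potential_eq is_chart_def\<close>)

lemma pd_potential:
  assumes "c \<in> A" "p \<in> fst c"
  shows "pd c k potential p = - pd c k (chart_div g \<xi> c) p"
proof -
  have "pd c k potential p = pd c k (\<lambda>q. - (l * CARD('n)) - chart_div g \<xi> c q) p"
    using assms by (intro pd_cong charts) (auto simp: potential_eq)
  also have "\<dots> = - pd c k (chart_div g \<xi> c) p"
    using chart_div_diff[OF assms] by (subst pd_diff) simp_all
  finally show ?thesis .
qed

lemma constant_iff:
  "potential constant_on carrier_of A \<longleftrightarrow> field_eq A (exterior_d potential) zero_field"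
proof
  assume "potential constant_on carrier_of A"
  then obtain a where a: "\<And>p. p \<in> carrier_of A \<Longrightarrow> potential p = a"
    by (auto simp: constant_on_def)
  have "pd c k potential p = 0" if "c \<in> A" "p \<in> fst c" for c p k
    using pd_cong[OF charts[OF that(1)] that(2), of potential "\<lambda>q. a"] a in_carrier[OF that(1)] by simp
  thus "field_eq A (exterior_d potential) zero_field"
    by (simp add: field_eq_def exterior_d_def vec_eq_iff)
next
  assume "field_eq A (exterior_d potential) zero_field"
  thus "potential constant_on carrier_of A"
    by (intro constant_on_if_pd_zero charts connected potential_diff)
      (auto simp: field_eq_def exterior_d_def vec_eq_iff)
qed

text \<open>\<open>ricci_op\<close> contracts X with the first slot of the Ricci tensor, the Ricci
  identity with the second; \<open>ricci_sym\<close> reconciles them.\<close>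

lemma flat_ricci_op:
  assumes "c \<in> A" "p \<in> fst c"
  shows "flat g (ricci_op g \<xi>) c p $ k = (\<Sum>m\<in>UNIV. ricci g c p $ k $ m * \<xi> c p $ m)"
proof -
  interpret riemannian_chart A g c using assms(1) by (rule riemannian_chart)
  show ?thesis
    by (simp add: ricci_op_def flat_sharp[OF assms(2)] ricci_sym[OF assms, of _ k])
qed

lemma S_sharp_flat:
  assumes "c \<in> A" "p \<in> fst c"
  shows "S_sharp g (flat g \<xi>) c p = flat g (ricci_op g \<xi>) c p"
proof -
  interpret riemannian_chart A g c using assms(1) by (rule riemannian_chart)
  show ?thesis
    by (simp add: S_sharp_def ricci_op_def flat_sharp[OF assms(2)] sharp_flat[OF assms(2)])
qed

lemma in_ker_Q_iff: "in_ker_Q A g \<xi> \<longleftrightarrow> field_eq A (flat g (ricci_op g \<xi>)) zero_field"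
proof -
  have "ricci_op g \<xi> c p = 0 \<longleftrightarrow> flat g (ricci_op g \<xi>) c p = 0" if "c \<in> A" "p \<in> fst c" for c p
  proof
    assume "flat g (ricci_op g \<xi>) c p = 0"
    hence "sharp g (flat g (ricci_op g \<xi>)) c p = 0"
      by (simp add: sharp_def)
    thus "ricci_op g \<xi> c p = 0"
      using riemannian_chart.sharp_flat[OF riemannian_chart[OF that(1)] that(2)] by simp
  qed (simp add: flat_def vec_eq_iff)
  thus ?thesis
    by (simp add: in_ker_Q_def field_eq_def)
qed

text \<open>\<open>sharp g (flat g \<xi>)\<close> is known to agree with \<xi> on chart domains, not
  as a function, so the agreement is carried by \<open>pd_cong\<close> through both layers of
  differentiation before the general formula applies. The minus sign is that of
  \<open>pd_potential\<close>.\<close>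

lemma div_lie_deriv_eq:
  assumes "c \<in> A" "p \<in> fst c"
  shows "div_tensor g (lie_deriv (sharp g (flat g \<xi>)) g) c p =
    laplacian g (flat g \<xi>) c p + flat g (ricci_op g \<xi>) c p - exterior_d potential c p"
proof -
  interpret riemannian_chart A g c using assms(1) by (rule riemannian_chart)
  have sf: "sharp g (flat g \<xi>) c q = \<xi> c q" if "q \<in> fst c" for q
    using sharp_flat[OF that] .
  have lie: "lie_deriv (sharp g (flat g \<xi>)) g c q = lie_deriv \<xi> g c q" if "q \<in> fst c" for q
  proof -
    have "pd c i (\<lambda>q. sharp g (flat g \<xi>) c q $ k) q = pd c i (\<lambda>q. \<xi> c q $ k) q" for i k
      by (rule pd_cong[OF chart that]) (simp add: sf)
    thus ?thesis
      by (simp add: lie_deriv_def sf[OF that])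
  qed
  have "nabla_tensor g (lie_deriv (sharp g (flat g \<xi>)) g) c p k = nabla_tensor g (lie_deriv \<xi> g) c p k" for k
  proof -
    have "pd c k (\<lambda>q. lie_deriv (sharp g (flat g \<xi>)) g c q $ i $ j) p = pd c k (\<lambda>q. lie_deriv \<xi> g c q $ i $ j) p"
      for i j
      by (rule pd_cong[OF chart assms(2)]) (simp add: lie)
    thus ?thesis
      by (simp add: nabla_tensor_def lie[OF assms(2)])
  qed
  hence "div_tensor g (lie_deriv (sharp g (flat g \<xi>)) g) c p = div_tensor g (lie_deriv \<xi> g) c p"
    by (simp add: div_tensor_def)
  thus ?thesis
    by (simp add: vec_eq_iff div_lie_deriv_metric[OF field assms(2)] flat_ricci_op[OF assms]
        exterior_d_def pd_potential[OF assms] chart_div_def[abs_def])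
qed

text \<open>With zero divergence, \<open>potential_eq\<close> leaves the constant -l n. The
  hypothesis speaks of the chart \<open>chart_at A p\<close>; \<open>chart_div_chart_at\<close>
  passes it on to every chart around \<open>p\<close>.\<close>

lemma divergence_free_imp:
  assumes "divergence_free A g (flat g \<xi>)"
  shows "field_eq A (exterior_d potential) zero_field"
proof -
  have "chart_div g \<xi> c p = 0" if "c \<in> A" "p \<in> fst c" for c p
  proof -
    define c0 where "c0 = chart_at A p"
    have c0: "c0 \<in> A" "p \<in> fst c0"
      using chart_at[OF in_carrier[OF that]] by (simp_all add: c0_def)
    interpret riemannian_chart A g c0 using c0(1) by (rule riemannian_chart)
    have "pd c0 i (\<lambda>q. sharp g (flat g \<xi>) c0 q $ k) p = pd c0 i (\<lambda>q. \<xi> c0 q $ k) p" for i k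
      by (rule pd_cong[OF chart c0(2)]) (simp add: sharp_flat)
    hence "div_vfield A g (sharp g (flat g \<xi>)) p = chart_div g \<xi> c0 p"
      by (simp add: div_vfield_def Let_def chart_div_def nabla_vfield_def sharp_flat[OF c0(2)]
          flip: c0_def)
    thus ?thesis
      using assms in_carrier[OF that] chart_div_chart_at[OF that] by (simp add: divergence_free_def c0_def)
  qed
  hence "potential p = - l * CARD('n)" if "p \<in> carrier_of A" for p
    using that potential_eq by (auto simp: carrier_of_def)
  thus ?thesis
    unfolding constant_iff[symmetric] constant_on_def by blast
qed

end

theorem lemma2p10:
  fixes A :: "('a::{t2_space, second_countable_topology}, 'n::finite) chart set"
    and g :: "('a, 'n) tensor2"
    and \<xi> :: "('a, 'n) vfield"
    and \<eta> :: "('a, 'n) form1"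
    and l \<mu> :: real
  assumes manifold: "smooth_manifold A" "connected (carrier_of A)"
    and dim: "CARD('n) > 2"
    and soliton: "eta_ricci_soliton A g \<xi> l \<mu>"
    and eta: "\<eta> = flat g \<xi>"
    and harmonic_convention: "harmonic_form A g \<eta> \<longleftrightarrow> closed_form A \<eta> \<and> divergence_free A g \<eta>"
  shows
    "(schrodinger_ricci_solution A g \<eta> \<longrightarrow>
        (schrodinger_ricci_harmonic A g \<eta> \<longleftrightarrow>
           (\<lambda>p. scal A g p + \<mu> * norm_sq A g \<xi> p) constant_on carrier_of A) \<and>
        (harmonic_form A g \<eta> \<longleftrightarrow>
           field_eq A (flat g (ricci_op g \<xi>)) (exterior_d (\<lambda>p. scal A g p + \<mu> * norm_sq A g \<xi> p))) \<and>
        (harmonic_form A g \<eta> \<longrightarrow> in_ker_Q A g \<xi>)) \<and>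
     (schrodinger_ricci_harmonic A g \<eta> \<longrightarrow>
        (schrodinger_ricci_solution A g \<eta> \<longleftrightarrow>
           (\<lambda>p. scal A g p + \<mu> * norm_sq A g \<xi> p) constant_on carrier_of A) \<and>
        (harmonic_form A g \<eta> \<longleftrightarrow> in_ker_Q A g \<xi>)) \<and>
     (harmonic_form A g \<eta> \<longrightarrow>
        (schrodinger_ricci_solution A g \<eta> \<longleftrightarrow> in_ker_Q A g \<xi>) \<and>
        (schrodinger_ricci_harmonic A g \<eta> \<longleftrightarrow> in_ker_Q A g \<xi>))"
proof -
  interpret eta_soliton A g \<xi> l \<mu>
    using manifold soliton by unfold_locales
  define L where "L = laplacian g \<eta>"
  define Q where "Q = flat g (ricci_op g \<xi>)"
  define d :: "('a, 'n) form1" where "d = exterior_d potential"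
  have pot: "(\<lambda>p. scal A g p + \<mu> * norm_sq A g \<xi> p) = potential"
    by (simp add: potential_def[abs_def])
  have sol: "schrodinger_ricci_solution A g \<eta> \<longleftrightarrow> (\<forall>c\<in>A. \<forall>p\<in>fst c. L c p + Q c p - d c p = 0)"
    by (simp add: schrodinger_ricci_solution_def field_eq_def div_lie_deriv_eq L_def Q_def d_def eta)
  have srh: "schrodinger_ricci_harmonic A g \<eta> \<longleftrightarrow> (\<forall>c\<in>A. \<forall>p\<in>fst c. L c p + Q c p = 0)"
    by (simp add: schrodinger_ricci_harmonic_def field_eq_def S_sharp_flat L_def Q_def eta)
  have harm: "harmonic_form A g \<eta> \<longleftrightarrow> (\<forall>c\<in>A. \<forall>p\<in>fst c. L c p = 0)"
    by (simp add: harmonic_form_def field_eq_def L_def)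
  have ker: "in_ker_Q A g \<xi> \<longleftrightarrow> (\<forall>c\<in>A. \<forall>p\<in>fst c. Q c p = 0)"
    by (simp add: in_ker_Q_iff field_eq_def Q_def)
  have const: "potential constant_on carrier_of A \<longleftrightarrow> (\<forall>c\<in>A. \<forall>p\<in>fst c. d c p = 0)"
    by (simp add: constant_iff field_eq_def d_def)
  \<comment> \<open>The convention on harmonic forms enters here, through divergence-freeness. For a
    harmonic solution \<open>L\<close> = 0 leaves \<open>Q\<close> = \<open>d\<close>, and
    \<open>d\<close> = 0 then gives the kernel statements in i) and iii a).\<close>
  have harm_d: "\<forall>c\<in>A. \<forall>p\<in>fst c. d c p = 0" if "harmonic_form A g \<eta>"
    using that harmonic_convention divergence_free_imp by (simp add: field_eq_def d_def eta)
  have Qd: "field_eq A (flat g (ricci_op g \<xi>)) (exterior_d potential) \<longleftrightarrow> (\<forall>c\<in>A. \<forall>p\<in>fst c. Q c p = d c p)"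
    by (simp add: field_eq_def Q_def d_def)
  show ?thesis
    using harm_d unfolding pot sol srh harm ker const Qd by (auto simp: algebra_simps)
qed

end
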